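(* Let $f$ be any function with property $P^{\ast}$ and let $n\geq 6$. Then for every tree $T$ of order $n$ with $T\not\cong S_{n}$, $T\not\cong S_{2,n-2}$, $T\not\cong S_{3,n-3}$, we have $$\rho(A_{f}(T))<\rho(A_{f}(S_{3,n-3}))<\rho(A_{f}(S_{2,n-2}))<\rho(A_{f}(S_{n})).$$ That is, $S_{n}$, $S_{2,n-2}$, $S_{3,n-3}$ are, respectively, the unique trees of order $n$ with the first, second and third largest spectral radius of $A_f$.
   Context: All graphs are simple and connected; $d_i$ denotes the degree of vertex $v_i$. A function $f(x,y)$ (positive, symmetric in $x,y$, twice differentiable in $x$) has property $P^{\ast}$ if $f(x,y)>0$, $f'_x(x,y)\geq 0$ and $f''_x(x,y)\geq 0$ (increasing and convex in $x$), and whenever $x_1+y_1=x_2+y_2$ and $|x_1-y_1|>|x_2-y_2|$ we have $f(x_1,y_1)\geq f(x_2,y_2)$. For a graph $G$ on $\{v_1,\dots,v_n\}$, the weighted adjacency matrix $A_f(G)$ has $(i,j)$-entry $f(d_i,d_j)$ if $v_iv_j\in E(G)$ and $0$ otherwise; $\rho(A_f(G))$ denotes its largest eigenvalue. $S_n$ is the star of order $n$. For $2\leq d\leq\lfloor n/2\rfloor$, the double star $S_{d,n-d}$ is the tree of order $n$ consisting of two adjacent vertices $v_1,v_2$, where $v_1$ is adjacent to $d-1$ further pendant vertices and $v_2$ to $n-d-1$ further pendant vertices (so $d_{1}=d$, $d_{2}=n-d$). *)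

theory Defs
  imports Complex_Main "Jordan_Normal_Form.Char_Poly"
begin

text \<open>Property P* for f :: real => real => real, on positive arguments.\<close>
definition P_star :: "(real \<Rightarrow> real \<Rightarrow> real) \<Rightarrow> bool" where
  "P_star f \<longleftrightarrow>
     (\<forall>x y. x > 0 \<longrightarrow> y > 0 \<longrightarrow> f x y > 0 \<and> f x y = f y x) \<and>
     (\<forall>y>0. \<exists>f1 f2. \<forall>x>0.
        ((\<lambda>t. f t y) has_real_derivative f1 x) (at x) \<and>
        (f1 has_real_derivative f2 x) (at x) \<and> f1 x \<ge> 0 \<and> f2 x \<ge> 0) \<and>
     (\<forall>x1 y1 x2 y2. x1 > 0 \<longrightarrow> y1 > 0 \<longrightarrow> x2 > 0 \<longrightarrow> y2 > 0 \<longrightarrow>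
        x1 + y1 = x2 + y2 \<longrightarrow> \<bar>x1 - y1\<bar> > \<bar>x2 - y2\<bar> \<longrightarrow> f x1 y1 \<ge> f x2 y2)"

text \<open>A simple graph on vertex set {0..<n}: a set of 2-element edges.\<close>
definition simple_graph :: "nat \<Rightarrow> nat set set \<Rightarrow> bool" where
  "simple_graph n E \<longleftrightarrow> (\<forall>e\<in>E. \<exists>u v. e = {u, v} \<and> u \<noteq> v \<and> u < n \<and> v < n)"

definition adj_rel :: "nat set set \<Rightarrow> (nat \<times> nat) set" where
  "adj_rel E = {(u, v). {u, v} \<in> E}"

definition connected_graph :: "nat \<Rightarrow> nat set set \<Rightarrow> bool" where
  "connected_graph n E \<longleftrightarrow> (\<forall>u<n. \<forall>v<n. (u, v) \<in> (adj_rel E)\<^sup>*)"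

definition is_tree :: "nat \<Rightarrow> nat set set \<Rightarrow> bool" where
  "is_tree n E \<longleftrightarrow> n \<ge> 1 \<and> simple_graph n E \<and> connected_graph n E \<and> card E = n - 1"

definition degree :: "nat set set \<Rightarrow> nat \<Rightarrow> nat" where
  "degree E v = card {u. {u, v} \<in> E}"

definition weighted_adj :: "(real \<Rightarrow> real \<Rightarrow> real) \<Rightarrow> nat \<Rightarrow> nat set set \<Rightarrow> real mat" where
  "weighted_adj f n E = mat n n (\<lambda>(i, j).
     if {i, j} \<in> E then f (real (degree E i)) (real (degree E j)) else 0)"

text \<open>Largest eigenvalue.\<close>
definition largest_eig :: "real mat \<Rightarrow> real" where
  "largest_eig A = Max {k. eigenvalue A k}"

definition rho_f :: "(real \<Rightarrow> real \<Rightarrow> real) \<Rightarrow> nat \<Rightarrow> nat set set \<Rightarrow> real" where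
  "rho_f f n E = largest_eig (weighted_adj f n E)"

definition graph_iso :: "nat \<Rightarrow> nat set set \<Rightarrow> nat set set \<Rightarrow> bool" where
  "graph_iso n E E' \<longleftrightarrow> (\<exists>\<pi>. bij_betw \<pi> {..<n} {..<n} \<and> E' = (\<lambda>e. \<pi> ` e) ` E)"

text \<open>Star S_n: centre 0 joined to 1..n-1.\<close>
definition star :: "nat \<Rightarrow> nat set set" where
  "star n = {{0, i} | i. 1 \<le> i \<and> i < n}"

text \<open>Double star S_{d,n-d}: 0 ~ 1; 0 ~ 2..d (d-1 pendants); 1 ~ d+1..n-1 (n-d-1 pendants).\<close>
definition double_star :: "nat \<Rightarrow> nat \<Rightarrow> nat set set" where
  "double_star d n = {{0, 1}} \<union> {{0, i} | i. 2 \<le> i \<and> i \<le> d} \<union> {{1, i} | i. d < i \<and> i < n}"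

end

theory Submission
  imports Defs "HOL-Analysis.Convex" "Jordan_Normal_Form.Spectral_Radius"
begin

text \<open>
  Root a tree T at a vertex u of degree n - d, and let m be the number of edges of the branch hanging
  below a neighbour w of u. The branches have n - 1 vertices altogether, so the m add up to d - 1.
  Every edge not at u has weight at most s = f 1 d, because the degrees of its endpoints add up to at
  most d + 1. Completing squares in the quadratic form, and using the Cauchy--Schwarz inequality
  inside a branch, every eigenvalue of T is at most the square root of x as soon as the sum over w of
  the square of f (n - d) (m + 1), divided by 1 - m s^2 / x, is at most x. Each summand is
  bounded by a convex function of m, so the sum is largest when all of the d - 1 edges lie in a single
  branch; then T is the double star with parameters d and n - d, and the sum equals x
  for its squared spectral radius x. Hence this double star maximises the spectral radius, uniquely,
  among the trees having a vertex of degree n - d.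

  The spectral radius of the double star decreases while d grows up to n / 2. Apart from S_n and
  S_{2,n-2}, every tree has a vertex of degree between 3 and n - 3 or has maximum degree 2; in the
  latter case the row sums show that the spectral radius is below 2 f 2 2.
\<close>

section \<open>Property P*\<close>

text \<open>Write A for the weighted adjacency matrix and x = mu^2. Eliminating the vertices of T
  from \<open>mu * I - A\<close> towards u produces the denominators: a branch whose m edges all
  meet in w and have weight s leaves the coefficient mu * (1 - m * s^2 / x) at w. Cauchy--Schwarz
  shows that no other shape of a branch with m edges is worse than this star. Convexity in m is that
  of the perspective function (p, q) |-> p^2 / q: the denominator is affine in m, and convexity of f
  puts the weight of uw below an affine function of m. The obstacle is that weights depend on
  degrees, so moving one edge changes the weights of others. Testing the whole tree at once against
  the number x of the extremal double star avoids any chain of intermediate trees. The vertex u need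
  not have maximum degree; any degree from 3 to n - 3 serves. If it is neither 3 nor n - 3, a weak
  bound is enough, since double stars are strictly ordered; at these two values strictness has to
  come from the shape of T.\<close>

lemma P_star_pos: "P_star f \<Longrightarrow> x > 0 \<Longrightarrow> y > 0 \<Longrightarrow> f x y > 0"
  by (simp add: P_star_def)

lemma P_star_sym: "P_star f \<Longrightarrow> x > 0 \<Longrightarrow> y > 0 \<Longrightarrow> f x y = f y x"
  by (simp add: P_star_def)

lemma P_star_derivatives:
  assumes "P_star f" "0 < y"
  obtains f1 f2 where "\<And>x. x > 0 \<Longrightarrow> ((\<lambda>t. f t y) has_real_derivative f1 x) (at x)"
    "\<And>x. x > 0 \<Longrightarrow> (f1 has_real_derivative f2 x) (at x)"
    "\<And>x. x > 0 \<Longrightarrow> f1 x \<ge> 0" "\<And>x. x > 0 \<Longrightarrow> f2 x \<ge> 0"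
proof -
  have "\<exists>f1 f2. \<forall>x>0. ((\<lambda>t. f t y) has_real_derivative f1 x) (at x) \<and>
        (f1 has_real_derivative f2 x) (at x) \<and> f1 x \<ge> 0 \<and> f2 x \<ge> 0"
    using spec[OF assms(1)[unfolded P_star_def, THEN conjunct2, THEN conjunct1], of y] assms(2)
    by (rule mp)
  then show ?thesis
  proof (elim exE)
    fix f1 f2
    assume h: "\<forall>x>0. ((\<lambda>t. f t y) has_real_derivative f1 x) (at x) \<and>
        (f1 has_real_derivative f2 x) (at x) \<and> f1 x \<ge> 0 \<and> f2 x \<ge> 0"
    show ?thesis by (rule that[of f1 f2]) (simp_all add: h)
  qed
qed

lemma P_star_mono:
  assumes f: "P_star f" and "0 < x" "x \<le> x'" "0 < y"
  shows "f x y \<le> f x' y"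
proof (rule P_star_derivatives[OF f \<open>0 < y\<close>])
  fix f1 f2
  assume d: "\<And>x. x > 0 \<Longrightarrow> ((\<lambda>t. f t y) has_real_derivative f1 x) (at x)"
    "\<And>x. x > 0 \<Longrightarrow> (f1 has_real_derivative f2 x) (at x)"
    "\<And>x. x > 0 \<Longrightarrow> f1 x \<ge> 0" "\<And>x. x > 0 \<Longrightarrow> f2 x \<ge> 0"
  have "\<exists>D. ((\<lambda>t. f t y) has_real_derivative D) (at t) \<and> 0 \<le> D" if "x \<le> t" for t
    using d[of t] that \<open>0 < x\<close> by (intro exI[of _ "f1 t"]) simp
  then show ?thesis
    by (intro DERIV_nonneg_imp_nondecreasing[OF \<open>x \<le> x'\<close>]) blast
qed

lemma P_star_mono2:
  assumes f: "P_star f" and "0 < x" "x \<le> x'" "0 < y" "y \<le> y'"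
  shows "f x y \<le> f x' y'"
proof -
  have "f x y \<le> f x' y" by (rule P_star_mono[OF f]) (use assms in auto)
  also have "\<dots> = f y x'" by (rule P_star_sym[OF f]) (use assms in auto)
  also have "\<dots> \<le> f y' x'" by (rule P_star_mono[OF f]) (use assms in auto)
  also have "\<dots> = f x' y'" by (rule P_star_sym[OF f]) (use assms in auto)
  finally show ?thesis .
qed

lemma P_star_convex:
  assumes f: "P_star f" and "0 < y"
  shows "convex_on {0<..} (\<lambda>t. f t y)"
proof (rule P_star_derivatives[OF f \<open>0 < y\<close>])
  fix f1 f2
  assume d: "\<And>x. x > 0 \<Longrightarrow> ((\<lambda>t. f t y) has_real_derivative f1 x) (at x)"
    "\<And>x. x > 0 \<Longrightarrow> (f1 has_real_derivative f2 x) (at x)"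
    "\<And>x. x > 0 \<Longrightarrow> f1 x \<ge> 0" "\<And>x. x > 0 \<Longrightarrow> f2 x \<ge> 0"
  show ?thesis
    by (rule f''_ge0_imp_convex[where f' = f1 and f'' = f2]) (use d in auto)
qed

lemma P_star_apart:
  assumes "P_star f" and "x1 > 0" "y1 > 0" "x2 > 0" "y2 > 0"
    and "x1 + y1 = x2 + y2" "\<bar>x2 - y2\<bar> < \<bar>x1 - y1\<bar>"
  shows "f x2 y2 \<le> f x1 y1"
  using assms unfolding P_star_def by blast

text \<open>Among pairs of fixed sum the extreme pair has the greatest weight. The inequality in P*
  requires a strictly larger difference, so pairs that are already extreme are handled by
  symmetry.\<close>

lemma P_star_spread:
  assumes f: "P_star f" and "x \<ge> 1" "y \<ge> 1"
  shows "f x y \<le> f 1 (x + y - 1)"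
proof (cases "x = 1 \<or> y = 1")
  case True
  then show ?thesis using P_star_sym[OF f, of x y] assms by auto
next
  case False
  show ?thesis by (rule P_star_apart[OF f]) (use assms False in auto)
qed

section \<open>Two convexity inequalities\<close>

lemma convex_on_increment_mono:
  fixes g :: "real \<Rightarrow> real"
  assumes g: "convex_on {0<..} g" and "0 < a" "a \<le> b"
  shows "g (a + 1) - g a \<le> g (b + 1) - g b"
proof -
  define L where "L = b + 1 - a"
  have L: "L > 0" using assms by (simp add: L_def)
  \<comment> \<open>With this weight, \<open>a + 1\<close> and \<open>b\<close> are complementary
    convex combinations of the endpoints \<open>a\<close> and \<open>b + 1\<close>, so adding the
    two convexity inequalities makes the weights cancel.\<close>
  define t where "t = 1 / L"
  have t: "0 \<le> t" "t \<le> 1" using assms by (auto simp: t_def L_def)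
  have tL: "t * L = 1" using L by (simp add: t_def)
  have e: "(1 - t) * a + t * (b + 1) = a + t * L" "t * a + (1 - t) * (b + 1) = b + 1 - t * L"
    by (simp_all add: L_def algebra_simps)
  have 1: "g (a + 1) \<le> (1 - t) * g a + t * g (b + 1)"
    using convex_onD[OF g t, of a "b + 1"] e(1) tL assms by simp
  have 2: "g b \<le> t * g a + (1 - t) * g (b + 1)"
    using convex_onD[OF g, of "1 - t" a "b + 1"] e(2) tL t assms by simp
  have "g (a + 1) + g b \<le> g a + g (b + 1)" using 1 2 by (simp add: algebra_simps)
  then show ?thesis by linarith
qed

text \<open>This is the chord inequality for (p, q) |-> p^2 / q on the segment from (a, 1) to (b, 1
  - \<tau>). With z = 1 - \<tau>, the gap is a positive multiple of t * (1 - t) * (z * a - b)^2; it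
  is nonzero in the strict case because z < 1 and a \<le> b give z * a < b.\<close>

lemma perspective_square_convex:
  fixes a b t \<tau> :: real
  assumes "0 \<le> t" "t \<le> 1" "\<tau> < 1" "0 \<le> \<tau>"
  shows "((1 - t) * a + t * b)\<^sup>2 / (1 - t * \<tau>) \<le> a\<^sup>2 + t * (b\<^sup>2 / (1 - \<tau>) - a\<^sup>2)"
    and "0 < t \<Longrightarrow> t < 1 \<Longrightarrow> 0 < a \<Longrightarrow> a \<le> b \<Longrightarrow> 0 < \<tau> \<Longrightarrow>
      ((1 - t) * a + t * b)\<^sup>2 / (1 - t * \<tau>) < a\<^sup>2 + t * (b\<^sup>2 / (1 - \<tau>) - a\<^sup>2)"
proof -
  define z where "z = 1 - \<tau>"
  have z: "z > 0" using assms by (simp add: z_def)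
  have "t * \<tau> \<le> \<tau>" using assms by (simp add: mult_left_le_one_le)
  then have p: "1 - t * \<tau> > 0" using assms by linarith
  have "(a\<^sup>2 + t * (b\<^sup>2 / z - a\<^sup>2)) * (1 - t * \<tau>) - ((1 - t) * a + t * b)\<^sup>2
      = t * (1 - t) * (z * a - b)\<^sup>2 / z"
    using z by (simp add: z_def field_simps power2_eq_square)
  then have id: "a\<^sup>2 + t * (b\<^sup>2 / z - a\<^sup>2) - ((1 - t) * a + t * b)\<^sup>2 / (1 - t * \<tau>)
      = t * (1 - t) * (z * a - b)\<^sup>2 / z / (1 - t * \<tau>)"
    using p by (simp add: field_simps)
  have "t * (1 - t) * (z * a - b)\<^sup>2 / z / (1 - t * \<tau>) \<ge> 0"
    using assms z p by simp
  with id show "((1 - t) * a + t * b)\<^sup>2 / (1 - t * \<tau>) \<le> a\<^sup>2 + t * (b\<^sup>2 / (1 - \<tau>) - a\<^sup>2)"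
    unfolding z_def by linarith
  assume s: "0 < t" "t < 1" "0 < a" "a \<le> b" "0 < \<tau>"
  have "z * a < a" using s by (simp add: z_def)
  then have "z * a - b \<noteq> 0" using s by linarith
  then have "t * (1 - t) * (z * a - b)\<^sup>2 / z / (1 - t * \<tau>) > 0"
    using s z p by simp
  with id show "((1 - t) * a + t * b)\<^sup>2 / (1 - t * \<tau>) < a\<^sup>2 + t * (b\<^sup>2 / (1 - \<tau>) - a\<^sup>2)"
    unfolding z_def by linarith
qed

section \<open>Eigenvalues of weighted adjacency matrices\<close>

lemma weighted_adj_carrier [simp]: "weighted_adj f n E \<in> carrier_mat n n"
  by (simp add: weighted_adj_def)

lemma mat_mult_vec_index:
  fixes A :: "'a :: comm_ring_1 mat"
  assumes "A \<in> carrier_mat n n" "v \<in> carrier_vec n" "i < n"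
  shows "(A *\<^sub>v v) $ i = (\<Sum>j<n. A $$ (i, j) * v $ j)"
  using assms by (simp add: scalar_prod_def lessThan_atLeast0)

lemma eigenvalue_iff_sums:
  fixes A :: "'a :: field mat"
  assumes A: "A \<in> carrier_mat n n"
  shows "eigenvalue A k \<longleftrightarrow>
    (\<exists>z. (\<exists>i<n. z i \<noteq> 0) \<and> (\<forall>i<n. (\<Sum>j<n. A $$ (i, j) * z j) = k * z i))"
proof
  assume "eigenvalue A k"
  then obtain v where v: "v \<in> carrier_vec n" "v \<noteq> 0\<^sub>v n" "A *\<^sub>v v = k \<cdot>\<^sub>v v"
    using A unfolding eigenvalue_def eigenvector_def by auto
  have "\<exists>i<n. v $ i \<noteq> 0"
  proof (rule ccontr)
    assume "\<not> ?thesis"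
    then have "v = 0\<^sub>v n" using v by (intro eq_vecI) auto
    with v show False by simp
  qed
  moreover have "\<forall>i<n. (\<Sum>j<n. A $$ (i, j) * v $ j) = k * v $ i"
    using mat_mult_vec_index[OF A v(1)] v by (metis index_smult_vec(1) carrier_vecD)
  ultimately show "\<exists>z. (\<exists>i<n. z i \<noteq> 0) \<and> (\<forall>i<n. (\<Sum>j<n. A $$ (i, j) * z j) = k * z i)"
    by blast
next
  assume "\<exists>z. (\<exists>i<n. z i \<noteq> 0) \<and> (\<forall>i<n. (\<Sum>j<n. A $$ (i, j) * z j) = k * z i)"
  then obtain z where z: "\<exists>i<n. z i \<noteq> 0" "\<forall>i<n. (\<Sum>j<n. A $$ (i, j) * z j) = k * z i" by blast
  define v where "v = vec n z"
  have v: "v \<in> carrier_vec n" by (simp add: v_def)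
  have "v \<noteq> 0\<^sub>v n" using z(1) by (metis index_vec index_zero_vec(1) v_def)
  moreover have "A *\<^sub>v v = k \<cdot>\<^sub>v v"
  proof (rule eq_vecI)
    fix i assume "i < dim_vec (k \<cdot>\<^sub>v v)"
    then have i: "i < n" by (simp add: v_def)
    show "(A *\<^sub>v v) $ i = (k \<cdot>\<^sub>v v) $ i"
      unfolding mat_mult_vec_index[OF A v i] using z(2) i by (simp add: v_def)
  qed (use A v in auto)
  ultimately show "eigenvalue A k"
    using A v unfolding eigenvalue_def eigenvector_def by auto
qed

text \<open>Guarantees that the set under \<open>Max\<close> in \<open>largest_eig\<close> is
  nonempty. A complex eigenvalue exists; the Hermitian form of a real symmetric matrix is its own
  conjugate, so the eigenvalue is real, and the real or the imaginary part of the eigenvector is a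
  nonzero real eigenvector.\<close>

lemma symmetric_real_eigenvalue_exists:
  fixes A :: "real mat"
  assumes A: "A \<in> carrier_mat n n" and n: "n > 0"
    and sym: "\<And>i j. i < n \<Longrightarrow> j < n \<Longrightarrow> A $$ (i, j) = A $$ (j, i)"
  shows "\<exists>k. eigenvalue A k"
proof -
  define C where "C = map_mat complex_of_real A"
  have C: "C \<in> carrier_mat n n" using A by (simp add: C_def)
  have Cij: "C $$ (i, j) = of_real (A $$ (i, j))" if "i < n" "j < n" for i j
    using A that by (simp add: C_def)
  obtain c where "eigenvalue C c" using spectrum_non_empty[OF C n] by (auto simp: spectrum_def)
  then obtain z where z: "\<exists>i<n. z i \<noteq> 0"
    and "\<forall>i<n. (\<Sum>j<n. C $$ (i, j) * z j) = c * z i"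
    using eigenvalue_iff_sums[OF C] by blast
  then have ev: "(\<Sum>j<n. of_real (A $$ (i, j)) * z j) = c * z i" if "i < n" for i
    using that by (simp add: Cij cong: sum.cong_simp)
  define S where "S = (\<Sum>i<n. (cmod (z i))\<^sup>2)"
  obtain i0 where "i0 < n" "z i0 \<noteq> 0" using z by blast
  then have S: "S > 0" unfolding S_def by (intro sum_pos2[of _ i0]) auto
  define Q where "Q = (\<Sum>i<n. \<Sum>j<n. of_real (A $$ (i, j)) * (cnj (z i) * z j))"
  have "c * of_real S = (\<Sum>i<n. cnj (z i) * (c * z i))"
    by (simp add: S_def sum_distrib_left complex_norm_square mult_ac del: of_real_power)
  also have "\<dots> = (\<Sum>i<n. cnj (z i) * (\<Sum>j<n. of_real (A $$ (i, j)) * z j))"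
    by (simp add: ev)
  also have "\<dots> = Q"
    by (simp add: Q_def sum_distrib_left mult.left_commute)
  finally have cQ: "c * of_real S = Q" .
  have "cnj Q = (\<Sum>i<n. \<Sum>j<n. of_real (A $$ (i, j)) * (cnj (z j) * z i))"
    by (simp add: Q_def mult.commute)
  also have "\<dots> = (\<Sum>j<n. \<Sum>i<n. of_real (A $$ (i, j)) * (cnj (z j) * z i))"
    by (rule sum.swap)
  also have "\<dots> = Q" unfolding Q_def
    by (intro sum.cong refl) (simp add: sym)
  finally have "cnj (c * of_real S) = c * of_real S" using cQ by simp
  then have "cnj c = c" using S by simp
  then have c: "c = of_real (Re c)" by (simp add: complex_cnj complex_eq_iff)
  have re: "(\<Sum>j<n. A $$ (i, j) * Re (z j)) = Re c * Re (z i)" if "i < n" for i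
  proof -
    have "Re (\<Sum>j<n. of_real (A $$ (i, j)) * z j) = Re (of_real (Re c) * z i)"
      using ev[OF that] c by simp
    then show ?thesis by simp
  qed
  have im: "(\<Sum>j<n. A $$ (i, j) * Im (z j)) = Re c * Im (z i)" if "i < n" for i
  proof -
    have "Im (\<Sum>j<n. of_real (A $$ (i, j)) * z j) = Im (of_real (Re c) * z i)"
      using ev[OF that] c by simp
    then show ?thesis by simp
  qed
  have "(\<exists>i<n. Re (z i) \<noteq> 0) \<or> (\<exists>i<n. Im (z i) \<noteq> 0)"
    using z by (auto simp: complex_eq_iff)
  then show ?thesis
  proof
    assume "\<exists>i<n. Re (z i) \<noteq> 0"
    then have "eigenvalue A (Re c)"
      unfolding eigenvalue_iff_sums[OF A] using re by (intro exI[of _ "\<lambda>i. Re (z i)"]) simp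
    then show ?thesis ..
  next
    assume "\<exists>i<n. Im (z i) \<noteq> 0"
    then have "eigenvalue A (Re c)"
      unfolding eigenvalue_iff_sums[OF A] using im by (intro exI[of _ "\<lambda>i. Im (z i)"]) simp
    then show ?thesis ..
  qed
qed

definition edge_weight :: "(real \<Rightarrow> real \<Rightarrow> real) \<Rightarrow> nat set set \<Rightarrow> nat \<Rightarrow> nat \<Rightarrow> real" where
  "edge_weight f E i j = f (real (Defs.degree E i)) (real (Defs.degree E j))"

lemma weighted_adj_index:
  "i < n \<Longrightarrow> j < n \<Longrightarrow> weighted_adj f n E $$ (i, j) = (if {i, j} \<in> E then edge_weight f E i j else 0)"
  by (simp add: weighted_adj_def edge_weight_def)

lemma finite_weighted_adj_eigenvalues: "finite {k. eigenvalue (weighted_adj f n E) k}"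
  using card_finite_spectrum(1)[OF weighted_adj_carrier] by (simp add: spectrum_def)

lemma eigenvalue_le_rho_f: "eigenvalue (weighted_adj f n E) k \<Longrightarrow> k \<le> rho_f f n E"
  unfolding rho_f_def largest_eig_def using finite_weighted_adj_eigenvalues by simp

lemma rho_f_is_eigenvalue:
  "eigenvalue (weighted_adj f n E) k \<Longrightarrow> eigenvalue (weighted_adj f n E) (rho_f f n E)"
  using Max_in[OF finite_weighted_adj_eigenvalues] unfolding rho_f_def largest_eig_def by blast

text \<open>P* speaks only of positive arguments, so symmetry, positivity and monotonicity of an
  edge weight all rest on this.\<close>

lemma degree_pos:
  assumes "finite E" "simple_graph n E" "{u, v} \<in> E"
  shows "Defs.degree E v > 0"
proof -
  have "{u. {u, v} \<in> E} \<subseteq> {..<n}"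
    using assms(2) unfolding simple_graph_def by (fastforce simp: doubleton_eq_iff)
  then have "finite {u. {u, v} \<in> E}" using finite_subset by blast
  then show ?thesis using assms(3) unfolding Defs.degree_def by (auto simp: card_gt_0_iff)
qed

lemma rho_f_eigenvalue:
  assumes f: "P_star f" and n: "n > 0" and E: "finite E" "simple_graph n E"
  shows "eigenvalue (weighted_adj f n E) (rho_f f n E)"
proof -
  have "\<exists>k. eigenvalue (weighted_adj f n E) k"
  proof (rule symmetric_real_eigenvalue_exists[OF weighted_adj_carrier n])
    fix i j assume "i < n" "j < n"
    then show "weighted_adj f n E $$ (i, j) = weighted_adj f n E $$ (j, i)"
      using degree_pos[OF E, of i j] degree_pos[OF E, of j i] P_star_sym[OF f]
      by (auto simp: weighted_adj_index edge_weight_def insert_commute)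
  qed
  then show ?thesis using rho_f_is_eigenvalue by blast
qed

text \<open>Collatz--Wielandt: compare an eigenvector with y at an index maximising the ratio.\<close>
lemma eigenvalue_le_of_positive_vector:
  fixes A :: "real mat"
  assumes A: "A \<in> carrier_mat n n" and ev: "eigenvalue A k"
    and nonneg: "\<And>i j. i < n \<Longrightarrow> j < n \<Longrightarrow> A $$ (i, j) \<ge> 0"
    and y: "\<And>i. i < n \<Longrightarrow> y i > 0"
    and Ay: "\<And>i. i < n \<Longrightarrow> (\<Sum>j<n. A $$ (i, j) * y j) \<le> \<mu> * y i"
  shows "k \<le> \<mu>"
proof -
  obtain z i0 where i0: "i0 < n" "z i0 \<noteq> 0"
    and z: "\<And>i. i < n \<Longrightarrow> (\<Sum>j<n. A $$ (i, j) * z j) = k * z i"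
    using ev eigenvalue_iff_sums[OF A] by blast
  define r where "r i = \<bar>z i\<bar> / y i" for i
  define R where "R = Max (r ` {..<n})"
  have "R \<in> r ` {..<n}" unfolding R_def using i0 by (intro Max_in) auto
  then obtain i where i: "i < n" "R = r i" by blast
  have R: "r j \<le> R" if "j < n" for j using that by (auto simp: R_def)
  have zR: "\<bar>z j\<bar> \<le> R * y j" if "j < n" for j
    using R[OF that] y[OF that] by (simp add: r_def pos_divide_le_eq)
  have "R > 0" using R[OF i0(1)] i0 y[OF i0(1)] by (smt (verit) r_def zero_less_abs_iff zero_less_divide_iff)
  have "k * (R * y i) = k * \<bar>z i\<bar>" using i y[OF i(1)] by (simp add: r_def)
  also have "\<dots> \<le> \<bar>k * z i\<bar>" by (simp add: abs_mult mult_right_mono)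
  also have "\<dots> \<le> (\<Sum>j<n. A $$ (i, j) * \<bar>z j\<bar>)"
    unfolding z[OF i(1), symmetric]
    by (rule order_trans[OF sum_abs]) (simp add: abs_mult nonneg i sum_mono)
  also have "\<dots> \<le> (\<Sum>j<n. A $$ (i, j) * (R * y j))"
    by (intro sum_mono mult_left_mono) (use zR nonneg i(1) in auto)
  also have "\<dots> = R * (\<Sum>j<n. A $$ (i, j) * y j)"
    by (simp add: sum_distrib_left mult.left_commute)
  also have "\<dots> \<le> R * (\<mu> * y i)" using Ay[OF i(1)] \<open>R > 0\<close> by simp
  finally have "k * (R * y i) \<le> \<mu> * (R * y i)" by (simp add: mult_ac)
  then show ?thesis using \<open>R > 0\<close> y[OF i(1)] by simp
qed

section \<open>Rooted trees\<close>

text \<open>Each edge is indexed by its lower endpoint, which turns sums over edges into sums over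
  the vertices other than \<open>u\<close>. The depth function rules out cycles and supplies the
  bipartition by parity.\<close>

locale rooted_tree =
  fixes n :: nat and E :: "nat set set" and u :: nat and par :: "nat \<Rightarrow> nat" and depth :: "nat \<Rightarrow> nat"
  assumes root: "u < n"
    and depth_root: "depth u = 0"
    and par: "v < n \<Longrightarrow> v \<noteq> u \<Longrightarrow> par v < n \<and> depth v = Suc (depth (par v))"
    and E_eq: "E = (\<lambda>v. {v, par v}) ` ({..<n} - {u})"
begin

abbreviation "V \<equiv> {..<n} - {u}"

text \<open>The restriction to \<open>V\<close> matters: \<open>par u\<close> is unconstrained, so
  \<open>u\<close> must not be counted as somebody's child.\<close>

definition children :: "nat \<Rightarrow> nat set" where
  "children v = {c \<in> V. par c = v}"

lemma finite_children [simp]: "finite (children v)"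
  by (simp add: children_def)

lemma edge_iff: "{a, b} \<in> E \<longleftrightarrow> (a \<in> V \<and> b = par a) \<or> (b \<in> V \<and> a = par b)"
  by (auto simp: E_eq doubleton_eq_iff)

lemma edge_less: "{a, b} \<in> E \<Longrightarrow> a < n \<and> b < n"
  using par by (auto simp: edge_iff)

lemma edge_parity: "{a, b} \<in> E \<Longrightarrow> even (depth a) \<longleftrightarrow> odd (depth b)"
  using par by (fastforce simp: edge_iff)

lemma par_neq: "v \<in> V \<Longrightarrow> par v \<noteq> v"
  using par[of v] by auto

lemma par_par_neq: "v \<in> V \<Longrightarrow> par v \<in> V \<Longrightarrow> par (par v) \<noteq> v"
  using par[of v] par[of "par v"] by auto

lemma finite_E: "finite E"
  by (simp add: E_eq)

lemma simple: "simple_graph n E"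
  unfolding simple_graph_def
proof
  fix e assume "e \<in> E"
  then obtain v where v: "v \<in> V" "e = {v, par v}" by (auto simp: E_eq)
  then show "\<exists>a b. e = {a, b} \<and> a \<noteq> b \<and> a < n \<and> b < n"
    using par[of v] par_neq[of v] by (intro exI[of _ v] exI[of _ "par v"]) auto
qed

lemma neighbours: "{w. {w, v} \<in> E} = children v \<union> (if v \<in> V then {par v} else {})"
  by (auto simp: edge_iff children_def)

lemma degree_eq: "v < n \<Longrightarrow> Defs.degree E v = card (children v) + (if v = u then 0 else 1)"
  using par_par_neq par_neq
  by (auto simp: Defs.degree_def neighbours card_insert_if children_def)

lemma finite_neighbours: "finite {w. {w, v} \<in> E}"
  by (rule finite_subset[of _ "{..<n}"]) (auto dest: edge_less)

text \<open>A common neighbour would close a triangle, whose three vertices would have pairwise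
  different parities of depth.\<close>

lemma neighbours_disjoint:
  assumes "{a, b} \<in> E"
  shows "{w. {w, a} \<in> E} \<inter> {w. {w, b} \<in> E} = {}"
proof -
  have False if "{w, a} \<in> E" "{w, b} \<in> E" for w
    using edge_parity[OF assms] edge_parity[OF that(1)] edge_parity[OF that(2)] by blast
  then show ?thesis by blast
qed

text \<open>The two neighbourhoods are disjoint subsets of \<open>S\<close>. This is the source of
  every bound on the sum of the degrees along an edge.\<close>

lemma degree_add_le:
  assumes "{a, b} \<in> E" "finite S" "{w. {w, a} \<in> E} \<subseteq> S" "{w. {w, b} \<in> E} \<subseteq> S"
  shows "Defs.degree E a + Defs.degree E b \<le> card S"
proof -
  have "Defs.degree E a + Defs.degree E b = card ({w. {w, a} \<in> E} \<union> {w. {w, b} \<in> E})"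
    unfolding Defs.degree_def
    by (rule card_Un_disjoint[symmetric]) (use neighbours_disjoint[OF assms(1)] finite_neighbours in auto)
  also have "\<dots> \<le> card S" using assms by (intro card_mono) auto
  finally show ?thesis .
qed

lemma edge_degree_pos: "{a, b} \<in> E \<Longrightarrow> Defs.degree E a > 0"
  using degree_pos[OF finite_E simple, of b a] by (simp add: insert_commute)

lemma edge_par: "v \<in> V \<Longrightarrow> {v, par v} \<in> E"
  by (simp add: edge_iff)

text \<open>The ordered adjacent pairs split into the orientation upwards, \<open>P\<close>, and the
  orientation downwards, \<open>P'\<close>; by symmetry both contribute the same.\<close>

lemma sum_over_edges:
  fixes W :: "nat \<Rightarrow> nat \<Rightarrow> real"
  assumes sym: "\<And>i j. {i, j} \<in> E \<Longrightarrow> W i j = W j i"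
  shows "(\<Sum>i<n. \<Sum>j<n. if {i, j} \<in> E then W i j else 0) = 2 * (\<Sum>v\<in>V. W v (par v))"
proof -
  define P where "P = (\<lambda>v. (v, par v)) ` V"
  define P' where "P' = (\<lambda>v. (par v, v)) ` V"
  have disj: "P \<inter> P' = {}"
    using par_par_neq par_neq by (auto simp: P_def P'_def)
  have PP: "P \<union> P' = {(i, j) \<in> {..<n} \<times> {..<n}. {i, j} \<in> E}"
    using edge_less par by (auto simp: P_def P'_def edge_iff)
  have "(\<Sum>i<n. \<Sum>j<n. if {i, j} \<in> E then W i j else 0)
      = (\<Sum>(i, j)\<in>{..<n} \<times> {..<n}. if {i, j} \<in> E then W i j else 0)"
    by (simp add: sum.cartesian_product)
  also have "\<dots> = (\<Sum>(i, j)\<in>P \<union> P'. W i j)"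
    unfolding PP by (intro sum.mono_neutral_cong_right) (auto split: if_splits)
  also have "\<dots> = (\<Sum>(i, j)\<in>P. W i j) + (\<Sum>(i, j)\<in>P'. W i j)"
    by (rule sum.union_disjoint) (auto simp: P_def P'_def disj[unfolded P_def P'_def])
  also have "(\<Sum>(i, j)\<in>P. W i j) = (\<Sum>v\<in>V. W v (par v))"
    unfolding P_def by (subst sum.reindex) (auto simp: inj_on_def)
  also have "(\<Sum>(i, j)\<in>P'. W i j) = (\<Sum>v\<in>V. W (par v) v)"
    unfolding P'_def by (subst sum.reindex) (auto simp: inj_on_def)
  also have "\<dots> = (\<Sum>v\<in>V. W v (par v))"
    by (intro sum.cong refl sym) (simp add: edge_iff)
  finally show ?thesis by simp
qed

text \<open>For \<open>v\<close> in \<open>V\<close> this is the ancestor at depth 1: climbing stops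
  one step short of \<open>u\<close>.\<close>

definition branch_root :: "nat \<Rightarrow> nat" where
  "branch_root v = (par ^^ (depth v - 1)) v"

text \<open>The branch contains \<open>w\<close> itself, so the number m of edges inside it is
  \<open>card (branch w) - 1\<close>; the edge from \<open>w\<close> to \<open>u\<close> is not
  among them.\<close>

definition branch :: "nat \<Rightarrow> nat set" where
  "branch w = {v \<in> V. branch_root v = w}"

lemma branch_root_child: "par v = u \<Longrightarrow> v \<in> V \<Longrightarrow> branch_root v = v"
  using par[of v] by (simp add: branch_root_def depth_root)

lemma branch_root_par:
  assumes "v \<in> V" "par v \<noteq> u"
  shows "branch_root (par v) = branch_root v"
proof -
  have "depth v = Suc (depth (par v))" "depth (par v) = Suc (depth (par (par v)))"
    using par[of v] par[of "par v"] assms by auto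
  then show ?thesis by (simp add: branch_root_def funpow_swap1)
qed

lemma branch_root_in:
  "v \<in> V \<Longrightarrow> branch_root v \<in> children u"
proof (induction "depth v" arbitrary: v rule: less_induct)
  case less
  show ?case
  proof (cases "par v = u")
    case True
    then show ?thesis using less by (simp add: branch_root_child children_def)
  next
    case False
    then show ?thesis using less branch_root_par[of v] par[of v] by fastforce
  qed
qed

lemma finite_branch [simp]: "finite (branch w)"
  by (simp add: branch_def)

lemma branches_partition: "(\<Union>w\<in>children u. branch w) = V"
  using branch_root_in by (auto simp: branch_def)

lemma branches_disjoint: "w \<noteq> w' \<Longrightarrow> branch w \<inter> branch w' = {}"
  by (auto simp: branch_def)

lemma sum_branches:
  "(\<Sum>v\<in>V. g v) = (\<Sum>w\<in>children u. \<Sum>v\<in>branch w. g v)"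
  unfolding branches_partition[symmetric]
  by (rule sum.UNION_disjoint) (use branches_disjoint in auto)

lemma card_branches: "(\<Sum>w\<in>children u. card (branch w)) = n - 1"
proof -
  have "(\<Sum>w\<in>children u. card (branch w)) = (\<Sum>v\<in>V. 1)"
    unfolding sum_branches by simp
  then show ?thesis using root by simp
qed

lemma in_branch_self: "w \<in> children u \<Longrightarrow> w \<in> branch w"
  by (simp add: branch_def children_def branch_root_child)

lemma children_in_branch:
  assumes "w \<in> children u"
  shows "children w \<subseteq> branch w - {w}"
proof
  fix c assume "c \<in> children w"
  then have "c \<in> V" "par c = w" by (auto simp: children_def)
  then show "c \<in> branch w - {w}"
    using assms branch_root_par[of c] branch_root_child[of w] par_neq[of c]
    by (auto simp: branch_def children_def)
qed

lemma par_in_branch: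
  assumes "w \<in> children u" "v \<in> branch w" "v \<noteq> w"
  shows "par v \<in> branch w"
proof -
  have v: "v \<in> V" "branch_root v = w" using assms by (auto simp: branch_def)
  then have "par v \<noteq> u" using branch_root_child[of v] assms(3) by auto
  then show ?thesis using branch_root_par[OF v(1)] v par[of v] by (auto simp: branch_def)
qed

lemma children_branch:
  assumes "v \<in> branch w"
  shows "children v \<subseteq> branch w"
proof
  fix c assume "c \<in> children v"
  then have "c \<in> V" "par c = v" by (auto simp: children_def)
  moreover have "v \<noteq> u" using assms by (auto simp: branch_def)
  ultimately show "c \<in> branch w" using assms branch_root_par[of c] by (auto simp: branch_def)
qed

lemma neighbours_branch:
  assumes "w \<in> children u" "v \<in> branch w"
  shows "{x. {x, v} \<in> E} \<subseteq> insert u (branch w)"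
proof -
  have "par v \<in> insert u (branch w)"
    using par_in_branch[OF assms] assms by (cases "v = w") (auto simp: children_def)
  then show ?thesis using children_branch[OF assms(2)] by (auto simp: neighbours)
qed

text \<open>Neighbours of vertices of a branch stay in the branch, except that \<open>w\<close> is
  also adjacent to \<open>u\<close>; that single extra vertex is the \<open>+ 1\<close>.\<close>

lemma degree_add_le_branch:
  assumes "w \<in> children u" "v \<in> branch w" "v \<noteq> w"
  shows "Defs.degree E v + Defs.degree E (par v) \<le> card (branch w) + 1"
proof -
  have v: "v \<in> V" using assms by (auto simp: branch_def)
  have "u \<notin> branch w" by (simp add: branch_def)
  then have c: "card (insert u (branch w)) = card (branch w) + 1" by simp
  show ?thesis unfolding c[symmetric]
    by (rule degree_add_le[OF edge_par[OF v]])
      (use neighbours_branch[OF assms(1)] assms(2) par_in_branch[OF assms] in auto)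
qed

text \<open>Climbing from \<open>v\<close> towards \<open>w\<close> passes through a child of
  \<open>w\<close>. In the equality case this shows that a branch with a vertex besides
  \<open>w\<close> has positive size even when counted by the children of \<open>w\<close>.\<close>

lemma branch_has_child:
  assumes "w \<in> children u" "v \<in> branch w" "v \<noteq> w"
  shows "children w \<noteq> {}"
  using assms(2,3)
proof (induction "depth v" arbitrary: v rule: less_induct)
  case less
  have v: "v \<in> V" using less by (auto simp: branch_def)
  show ?case
  proof (cases "par v = w")
    case True
    then show ?thesis using v by (auto simp: children_def)
  next
    case False
    show ?thesis
      by (rule less.hyps[of "par v"]) (use False par[of v] v par_in_branch[OF assms(1)] less.prems in auto)
  qed
qed

end

text \<open>Depth is the distance from \<open>u\<close>, and a parent is any neighbour one step
  closer. The parent edges are n - 1 distinct edges, so the edge count of a tree leaves no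
  others.\<close>

lemma tree_rooted:
  assumes T: "is_tree n E" and u: "u < n"
  obtains par depth where "rooted_tree n E u par depth"
proof -
  define R where "R = adj_rel E"
  define depth where "depth v = (LEAST k. (u, v) \<in> R ^^ k)" for v
  have simple: "simple_graph n E" and card: "card E = n - 1"
    and conn: "\<And>v. v < n \<Longrightarrow> (u, v) \<in> R\<^sup>*"
    using T u by (auto simp: is_tree_def connected_graph_def R_def)
  have R_less: "a < n \<and> b < n \<and> {b, a} \<in> E" if "(a, b) \<in> R" for a b
  proof -
    have "{a, b} \<in> E" using that by (simp add: R_def adj_rel_def)
    then show ?thesis using simple unfolding simple_graph_def
      by (fastforce simp: doubleton_eq_iff insert_commute)
  qed
  have reach: "(u, v) \<in> R ^^ depth v" if v: "v < n" for v
  proof -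
    obtain k where "(u, v) \<in> R ^^ k" using rtrancl_imp_relpow[OF conn[OF v]] by auto
    then show ?thesis unfolding depth_def by (rule LeastI)
  qed
  have depth_le: "depth v \<le> k" if "(u, v) \<in> R ^^ k" for v k
    unfolding depth_def using that by (rule Least_le)
  have "\<exists>p. p < n \<and> {v, p} \<in> E \<and> depth v = Suc (depth p)" if v: "v < n" "v \<noteq> u" for v
  proof -
    have "depth v \<noteq> 0" using reach[OF v(1)] v(2) by (intro notI) simp
    then obtain k where k: "depth v = Suc k" using not0_implies_Suc by blast
    then obtain p where p: "(u, p) \<in> R ^^ k" "(p, v) \<in> R" using reach[OF v(1)] by auto
    have "p < n" "{v, p} \<in> E" using R_less[OF p(2)] by auto
    moreover have "(u, v) \<in> R ^^ Suc (depth p)" using reach[OF \<open>p < n\<close>] p(2) by auto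
    then have "depth v \<le> Suc (depth p)" by (rule depth_le)
    ultimately show ?thesis using depth_le[OF p(1)] k by (intro exI[of _ p]) auto
  qed
  then obtain par where par: "\<And>v. v < n \<Longrightarrow> v \<noteq> u \<Longrightarrow> par v < n \<and> {v, par v} \<in> E \<and> depth v = Suc (depth (par v))"
    by metis
  define F where "F = (\<lambda>v. {v, par v}) ` ({..<n} - {u})"
  have finE: "finite E"
    by (rule finite_subset[of _ "Pow {..<n}"]) (use simple in \<open>auto simp: simple_graph_def\<close>)
  have "inj_on (\<lambda>v. {v, par v}) ({..<n} - {u})"
  proof (rule inj_onI)
    fix v w assume "v \<in> {..<n} - {u}" "w \<in> {..<n} - {u}" "{v, par v} = {w, par w}"
    then show "v = w" using par[of v] par[of w] by (auto simp: doubleton_eq_iff)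
  qed
  then have "card F = n - 1" using u by (simp add: F_def card_image)
  moreover have "F \<subseteq> E" using par by (auto simp: F_def)
  ultimately have "F = E" using card finE by (simp add: card_subset_eq)
  then have "rooted_tree n E u par depth"
    using u par by unfold_locales (auto simp: F_def depth_def intro!: Least_eq_0)
  then show ?thesis by (rule that)
qed

section \<open>The quadratic form of a rooted tree\<close>

context rooted_tree
begin

lemma card_branch_split:
  assumes w: "w \<in> children u"
  shows "card (children w) \<le> card (branch w) - 1"
    and "card (branch w - {w} - children w) = card (branch w) - 1 - card (children w)"
proof -
  have "card (branch w - {w}) = card (branch w) - 1"
    by (simp add: in_branch_self[OF w])
  then show "card (children w) \<le> card (branch w) - 1"
    "card (branch w - {w} - children w) = card (branch w) - 1 - card (children w)"
    using card_mono[OF _ children_in_branch[OF w]] card_Diff_subset[OF _ children_in_branch[OF w]]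
    by simp_all
qed

text \<open>Each of these edges joins a vertex of odd depth to one of even depth, and distinct edges give
  distinct pairs, so the left-hand side is a partial sum of the expanded product.\<close>
lemma branch_deep_edges_squares:
  fixes z :: "nat \<Rightarrow> real"
  assumes w: "w \<in> children u"
  shows "(\<Sum>v\<in>branch w - {w} - children w. (z v * z (par v))\<^sup>2)
    \<le> (\<Sum>v\<in>{v \<in> branch w - {w}. odd (depth v)}. (z v)\<^sup>2)
      * (\<Sum>v\<in>{v \<in> branch w - {w}. even (depth v)}. (z v)\<^sup>2)"
proof -
  let ?O = "branch w - {w} - children w"
  let ?R = "{v \<in> branch w - {w}. odd (depth v)}"
  let ?Q = "{v \<in> branch w - {w}. even (depth v)}"
  define g where "g v = (if odd (depth v) then (v, par v) else (par v, v))" for v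
  have O: "v \<in> V" "v \<in> branch w - {w}" "par v \<in> branch w - {w}" "par v \<in> V"
    "even (depth v) \<longleftrightarrow> odd (depth (par v))" if "v \<in> ?O" for v
  proof -
    show v: "v \<in> V" "v \<in> branch w - {w}" using that by (auto simp: branch_def)
    show p: "par v \<in> branch w - {w}"
      using par_in_branch[OF w, of v] that v by (auto simp: children_def)
    then show "par v \<in> V" by (auto simp: branch_def)
    show "even (depth v) \<longleftrightarrow> odd (depth (par v))" using edge_parity[OF edge_par[OF v(1)]] .
  qed
  have inj: "inj_on g ?O"
  proof (rule inj_onI)
    fix v v' assume vv: "v \<in> ?O" "v' \<in> ?O" "g v = g v'"
    show "v = v'"
    proof (rule ccontr)
      assume "v \<noteq> v'"
      then have "v = par v'" "par v = v'" using vv(3) by (auto simp: g_def split: if_splits)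
      then show False using par_par_neq[of v'] O[OF vv(1)] O[OF vv(2)] by auto
    qed
  qed
  have sub: "g ` ?O \<subseteq> ?R \<times> ?Q"
  proof
    fix x assume "x \<in> g ` ?O"
    then obtain v where "v \<in> ?O" "x = g v" by blast
    then show "x \<in> ?R \<times> ?Q" using O[of v] by (auto simp: g_def)
  qed
  have "(\<Sum>v\<in>?O. (z v * z (par v))\<^sup>2) = (\<Sum>v\<in>?O. case g v of (a, b) \<Rightarrow> (z a)\<^sup>2 * (z b)\<^sup>2)"
    by (intro sum.cong refl) (simp add: g_def power_mult_distrib)
  also have "\<dots> = (\<Sum>(a, b)\<in>g ` ?O. (z a)\<^sup>2 * (z b)\<^sup>2)"
    by (subst sum.reindex[OF inj]) simp
  also have "\<dots> \<le> (\<Sum>(a, b)\<in>?R \<times> ?Q. (z a)\<^sup>2 * (z b)\<^sup>2)"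
    by (intro sum_mono2 sub) auto
  also have "\<dots> = (\<Sum>v\<in>?R. (z v)\<^sup>2) * (\<Sum>v\<in>?Q. (z v)\<^sup>2)"
    by (simp add: sum_product sum.cartesian_product)
  finally show ?thesis .
qed

text \<open>With m edges in the branch, c of them at \<open>w\<close>, this is the amount by which
  eliminating the rest of the branch lowers the coefficient of the square at \<open>w\<close>. If
  all edges are at \<open>w\<close>, that is c = m, it reduces to m * s^2 / \<mu>.\<close>

definition branch_gain :: "real \<Rightarrow> real \<Rightarrow> nat \<Rightarrow> real" where
  "branch_gain s \<mu> w = real (card (children w)) * s\<^sup>2
     / (\<mu> - (real (card (branch w) - 1) - real (card (children w))) * s\<^sup>2 / \<mu>)"

text \<open>The edges not at \<open>w\<close> are estimated together, the edges at \<open>w\<close>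
  one by one. \<open>R\<close> and \<open>Q\<close> collect the squares at odd and even depth below
  \<open>w\<close>; since \<open>w\<close> has depth 1, its children lie on the even side.
  \<open>small\<close> keeps the coefficient \<alpha> left for that side positive.\<close>

lemma branch_form:
  fixes z wt :: "nat \<Rightarrow> real"
  assumes w: "w \<in> children u"
    and wt: "\<And>v. v \<in> branch w - {w} \<Longrightarrow> 0 \<le> wt v \<and> wt v \<le> s"
    and mu: "\<mu> > 0" and s: "s \<ge> 0" and small: "real (card (branch w) - 1) * s\<^sup>2 < \<mu>\<^sup>2"
  shows "(\<mu> - branch_gain s \<mu> w) * (z w)\<^sup>2
    \<le> \<mu> * (\<Sum>v\<in>branch w. (z v)\<^sup>2) - 2 * (\<Sum>v\<in>branch w - {w}. wt v * z v * z (par v))"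
proof -
  let ?O = "branch w - {w} - children w"
  define R where "R = (\<Sum>v\<in>{v \<in> branch w - {w}. odd (depth v)}. (z v)\<^sup>2)"
  define Q where "Q = (\<Sum>v\<in>{v \<in> branch w - {w}. even (depth v)}. (z v)\<^sup>2)"
  define k where "k = real (card (branch w) - 1) - real (card (children w))"
  define \<alpha> where "\<alpha> = \<mu> - k * s\<^sup>2 / \<mu>"
  have k: "k = real (card ?O)" "k \<ge> 0"
    using card_branch_split[OF w] by (auto simp: k_def of_nat_diff)
  have "k * s\<^sup>2 \<le> real (card (branch w) - 1) * s\<^sup>2"
    by (intro mult_right_mono) (auto simp: k_def)
  then have "k * s\<^sup>2 < \<mu> * \<mu>" using small by (simp add: power2_eq_square)
  then have \<alpha>: "\<alpha> > 0" using mu by (simp add: \<alpha>_def pos_divide_less_eq)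
  have RQ: "R \<ge> 0" "Q \<ge> 0" by (auto simp: R_def Q_def intro: sum_nonneg)
  have dw: "depth w = 1" using par[of w] w depth_root by (auto simp: children_def)
  have C_even: "children w \<subseteq> {v \<in> branch w - {w}. even (depth v)}"
  proof
    fix v assume v: "v \<in> children w"
    then have "depth v = Suc (depth w)" using par[of v] by (auto simp: children_def)
    then show "v \<in> {v \<in> branch w - {w}. even (depth v)}" using v dw children_in_branch[OF w] by auto
  qed

  have four_mult_le: "4 * p * q \<le> (p + q)\<^sup>2" for p q :: real
    using zero_le_power2[of "p - q"] by (simp add: power2_sum power2_diff)
  define X where "X = (\<Sum>v\<in>?O. \<bar>z v * z (par v)\<bar>)"
  have X0: "X \<ge> 0" by (simp add: X_def sum_nonneg)
  have "X\<^sup>2 \<le> (\<Sum>v\<in>?O. (z v * z (par v))\<^sup>2) * card ?O"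
    using sum_squared_le_sum_of_squares[of "\<lambda>v. \<bar>z v * z (par v)\<bar>" ?O] by (simp add: X_def)
  also have "\<dots> \<le> (R * Q) * k"
    unfolding k(1) R_def Q_def
    by (intro mult_right_mono branch_deep_edges_squares[OF w]) auto
  finally have X: "X\<^sup>2 \<le> R * Q * k" .
  \<comment> \<open>The inequality of arithmetic and geometric means is split unevenly: all of \<mu>
    * R is spent here, but only a part of \<mu> * Q, so that \<alpha> * Q remains for the edges
    between \<open>w\<close> and its children.\<close>
  have "(2 * s * X)\<^sup>2 = 4 * s\<^sup>2 * X\<^sup>2" by (simp add: power_mult_distrib)
  also have "\<dots> \<le> 4 * s\<^sup>2 * (R * Q * k)" using X by (intro mult_left_mono) auto
  also have "\<dots> = 4 * (\<mu> * R) * (k * s\<^sup>2 / \<mu> * Q)" using mu by simp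
  also have "\<dots> \<le> (\<mu> * R + k * s\<^sup>2 / \<mu> * Q)\<^sup>2"
    by (rule four_mult_le)
  finally have "2 * s * X \<le> \<mu> * R + k * s\<^sup>2 / \<mu> * Q"
    by (rule power2_le_imp_le) (use mu RQ k in auto)
  moreover have "(\<Sum>v\<in>?O. wt v * z v * z (par v)) \<le> s * X"
    unfolding X_def sum_distrib_left
  proof (rule sum_mono)
    fix v assume "v \<in> ?O"
    then have "0 \<le> wt v" "wt v \<le> s" using wt by auto
    then have "wt v * (z v * z (par v)) \<le> s * \<bar>z v * z (par v)\<bar>"
      by (meson abs_ge_self abs_ge_zero mult_left_mono mult_right_mono order_trans)
    then show "wt v * z v * z (par v) \<le> s * \<bar>z v * z (par v)\<bar>" by (simp add: mult.assoc)
  qed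
  ultimately have deep: "2 * (\<Sum>v\<in>?O. wt v * z v * z (par v)) \<le> \<mu> * R + k * s\<^sup>2 / \<mu> * Q" by linarith

  \<comment> \<open>Completing the square with the remaining coefficient \<alpha> costs s^2 /
    \<alpha> at \<open>w\<close> for each child; these costs add up to
    \<open>branch_gain\<close>.\<close>
  have child: "2 * (wt v * z v * z (par v)) \<le> \<alpha> * (z v)\<^sup>2 + s\<^sup>2 / \<alpha> * (z w)\<^sup>2" if v: "v \<in> children w" for v
  proof -
    have "0 \<le> wt v" "wt v \<le> s" using wt v children_in_branch[OF w] by auto
    then have "wt v * (z v * z w) \<le> s * (\<bar>z v\<bar> * \<bar>z w\<bar>)"
      unfolding abs_mult[symmetric]
      by (meson abs_ge_self abs_ge_zero mult_left_mono mult_right_mono order_trans)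
    moreover have "0 \<le> (\<alpha> * \<bar>z v\<bar> - s * \<bar>z w\<bar>)\<^sup>2 / \<alpha>" using \<alpha> by simp
    then have "2 * (s * (\<bar>z v\<bar> * \<bar>z w\<bar>)) \<le> \<alpha> * (z v)\<^sup>2 + s\<^sup>2 / \<alpha> * (z w)\<^sup>2"
      using \<alpha> by (simp add: power2_diff power_mult_distrib field_simps power2_eq_square)
    moreover have "par v = w" using v by (simp add: children_def)
    ultimately show ?thesis by (simp add: mult.assoc)
  qed
  have "2 * (\<Sum>v\<in>children w. wt v * z v * z (par v))
      \<le> (\<Sum>v\<in>children w. \<alpha> * (z v)\<^sup>2 + s\<^sup>2 / \<alpha> * (z w)\<^sup>2)"
    unfolding sum_distrib_left by (rule sum_mono) (rule child)
  also have "\<dots> = \<alpha> * (\<Sum>v\<in>children w. (z v)\<^sup>2) + branch_gain s \<mu> w * (z w)\<^sup>2"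
    by (simp add: sum.distrib sum_distrib_left branch_gain_def \<alpha>_def k_def)
  also have "\<dots> \<le> \<alpha> * Q + branch_gain s \<mu> w * (z w)\<^sup>2"
    unfolding Q_def using \<alpha> C_even by (intro add_right_mono mult_left_mono sum_mono2) auto
  finally have near: "2 * (\<Sum>v\<in>children w. wt v * z v * z (par v))
      \<le> \<alpha> * Q + branch_gain s \<mu> w * (z w)\<^sup>2" .

  have edges: "(\<Sum>v\<in>branch w - {w}. wt v * z v * z (par v))
      = (\<Sum>v\<in>children w. wt v * z v * z (par v)) + (\<Sum>v\<in>?O. wt v * z v * z (par v))"
    using sum.subset_diff[OF children_in_branch[OF w], of "\<lambda>v. wt v * z v * z (par v)"]
    by (simp add: add.commute)
  have "(\<Sum>v\<in>branch w. (z v)\<^sup>2) = (z w)\<^sup>2 + (\<Sum>v\<in>branch w - {w}. (z v)\<^sup>2)"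
    by (rule sum.remove) (use in_branch_self[OF w] in auto)
  also have "(\<Sum>v\<in>branch w - {w}. (z v)\<^sup>2) = R + Q"
    unfolding R_def Q_def
    by (subst sum.union_disjoint[symmetric]) (auto intro!: sum.cong)
  finally have squares: "(\<Sum>v\<in>branch w. (z v)\<^sup>2) = (z w)\<^sup>2 + (R + Q)" .
  have "\<alpha> * Q = \<mu> * Q - k * s\<^sup>2 / \<mu> * Q" by (simp add: \<alpha>_def left_diff_distrib)
  then show ?thesis
    unfolding edges squares using deep near by (simp add: algebra_simps)
qed

text \<open>The last elimination step: each branch leaves a positive coefficient at its top vertex,
  and completing the square against \<open>z u\<close> costs one summand of the hypothesis
  \<open>sum\<close>, whose total the term \<mu> * (z u)^2 can pay.\<close>

lemma tree_form:
  fixes z wt :: "nat \<Rightarrow> real"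
  assumes wt: "\<And>v. v \<in> V \<Longrightarrow> par v \<noteq> u \<Longrightarrow> 0 \<le> wt v \<and> wt v \<le> s"
    and mu: "\<mu> > 0" and s: "s \<ge> 0"
    and small: "\<And>w. w \<in> children u \<Longrightarrow> real (card (branch w) - 1) * s\<^sup>2 < \<mu>\<^sup>2"
    and gain: "\<And>w. w \<in> children u \<Longrightarrow> branch_gain s \<mu> w < \<mu>"
    and sum: "(\<Sum>w\<in>children u. (wt w)\<^sup>2 / (\<mu> - branch_gain s \<mu> w)) \<le> \<mu>"
  shows "2 * (\<Sum>v\<in>V. wt v * z v * z (par v)) \<le> \<mu> * (\<Sum>v<n. (z v)\<^sup>2)"
proof -
  have branch: "2 * (\<Sum>v\<in>branch w. wt v * z v * z (par v))
      \<le> \<mu> * (\<Sum>v\<in>branch w. (z v)\<^sup>2) + (wt w)\<^sup>2 / (\<mu> - branch_gain s \<mu> w) * (z u)\<^sup>2"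
    if w: "w \<in> children u" for w
  proof -
    define \<beta> where "\<beta> = \<mu> - branch_gain s \<mu> w"
    have \<beta>: "\<beta> > 0" using gain[OF w] by (simp add: \<beta>_def)
    have "0 \<le> wt v \<and> wt v \<le> s" if "v \<in> branch w - {w}" for v
      using that wt[of v] branch_root_child[of v] by (auto simp: branch_def)
    note form = branch_form[where z = z and wt = wt, OF w this mu s small[OF w], folded \<beta>_def]
    have split: "(\<Sum>v\<in>branch w. wt v * z v * z (par v))
        = wt w * z w * z u + (\<Sum>v\<in>branch w - {w}. wt v * z v * z (par v))"
      using w in_branch_self[OF w] by (subst sum.remove[of _ w]) (auto simp: children_def)
    have "0 \<le> (\<beta> * z w - wt w * z u)\<^sup>2 / \<beta>" using \<beta> by simp
    then have "2 * (wt w * z w * z u) \<le> \<beta> * (z w)\<^sup>2 + (wt w)\<^sup>2 / \<beta> * (z u)\<^sup>2"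
      using \<beta> by (simp add: power2_diff power_mult_distrib field_simps power2_eq_square)
    then show ?thesis using form unfolding split \<beta>_def[symmetric] by (simp add: algebra_simps)
  qed
  have "2 * (\<Sum>v\<in>V. wt v * z v * z (par v))
      \<le> (\<Sum>w\<in>children u. \<mu> * (\<Sum>v\<in>branch w. (z v)\<^sup>2)
          + (wt w)\<^sup>2 / (\<mu> - branch_gain s \<mu> w) * (z u)\<^sup>2)"
    unfolding sum_branches sum_distrib_left[of 2 _ "children u"] by (rule sum_mono) (rule branch)
  also have "\<dots> = \<mu> * (\<Sum>v\<in>V. (z v)\<^sup>2)
      + (\<Sum>w\<in>children u. (wt w)\<^sup>2 / (\<mu> - branch_gain s \<mu> w)) * (z u)\<^sup>2"
    by (simp add: sum.distrib sum_branches sum_distrib_left sum_distrib_right)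
  also have "\<dots> \<le> \<mu> * (\<Sum>v\<in>V. (z v)\<^sup>2) + \<mu> * (z u)\<^sup>2"
    by (intro add_left_mono mult_right_mono sum) auto
  also have "\<dots> = \<mu> * (\<Sum>v<n. (z v)\<^sup>2)"
    using root by (subst (2) sum.remove[of _ u]) (auto simp: algebra_simps)
  finally show ?thesis .
qed

end

section \<open>Comparison with a double star\<close>

text \<open>The squares of the nonzero eigenvalues of the weighted double star are the two roots of this
  quadratic; the side conditions single out the larger one. For d = 1 it is the star.\<close>
definition double_star_root :: "(real \<Rightarrow> real \<Rightarrow> real) \<Rightarrow> nat \<Rightarrow> nat \<Rightarrow> real \<Rightarrow> bool" where
  "double_star_root f n d x \<longleftrightarrow>
     x > real (d - 1) * (f 1 (real d))\<^sup>2 \<and>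
     x > real (n - d - 1) * (f 1 (real (n - d)))\<^sup>2 \<and>
     (x - real (d - 1) * (f 1 (real d))\<^sup>2) * (x - real (n - d - 1) * (f 1 (real (n - d)))\<^sup>2)
       = (f (real d) (real (n - d)))\<^sup>2 * x"

text \<open>With q = s^2 this says that a star is the worst branch with m edges. After clearing
  denominators the difference is q * (m - c) * (\<mu>^2 - m * q), which vanishes only if every edge
  of the branch is at its top.\<close>

lemma gain_bound:
  fixes c m q \<mu> :: real
  assumes "0 \<le> c" "c \<le> m" "m * q < \<mu>\<^sup>2" "0 < q" "0 < \<mu>"
  shows "\<mu> * (c * q / (\<mu> - (m - c) * q / \<mu>)) \<le> m * q"
    and "c < m \<Longrightarrow> \<mu> * (c * q / (\<mu> - (m - c) * q / \<mu>)) < m * q"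
proof -
  define y where "y = \<mu>\<^sup>2 - (m - c) * q"
  have "(m - c) * q \<le> m * q" using assms by (intro mult_right_mono) auto
  then have y: "y > 0" using assms(3) unfolding y_def by linarith
  have "\<mu> - (m - c) * q / \<mu> = y / \<mu>" using assms by (simp add: y_def field_simps power2_eq_square)
  then have e: "\<mu> * (c * q / (\<mu> - (m - c) * q / \<mu>)) = c * q * \<mu>\<^sup>2 / y"
    by (simp add: power2_eq_square)
  have d: "m * q * y - c * q * \<mu>\<^sup>2 = q * ((m - c) * (\<mu>\<^sup>2 - m * q))"
    by (simp add: y_def algebra_simps)
  have "q * ((m - c) * (\<mu>\<^sup>2 - m * q)) \<ge> 0" using assms by simp
  then show "\<mu> * (c * q / (\<mu> - (m - c) * q / \<mu>)) \<le> m * q"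
    unfolding e using d y by (simp add: pos_divide_le_eq)
  assume "c < m"
  then have "q * ((m - c) * (\<mu>\<^sup>2 - m * q)) > 0" using assms by simp
  then show "\<mu> * (c * q / (\<mu> - (m - c) * q / \<mu>)) < m * q"
    unfolding e using d y by (simp add: pos_divide_less_eq)
qed

context rooted_tree
begin

text \<open>Pair the eigenvector with itself: its quadratic form is \<open>k\<close> times its
  squared norm, and each edge occurs in it twice.\<close>

lemma eigenvalue_form_le:
  assumes f: "P_star f" and ev: "eigenvalue (weighted_adj f n E) k"
    and form: "\<And>z. 2 * (\<Sum>v\<in>V. edge_weight f E v (par v) * z v * z (par v)) \<le> \<mu> * (\<Sum>v<n. (z v)\<^sup>2)"
  shows "k \<le> \<mu>"
proof -
  obtain z i0 where i0: "i0 < n" "z i0 \<noteq> 0"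
    and z: "\<And>i. i < n \<Longrightarrow> (\<Sum>j<n. weighted_adj f n E $$ (i, j) * z j) = k * z i"
    using ev eigenvalue_iff_sums[OF weighted_adj_carrier] by blast
  have S: "(\<Sum>v<n. (z v)\<^sup>2) > 0" by (rule sum_pos2[of _ i0]) (use i0 in auto)
  have "k * (\<Sum>v<n. (z v)\<^sup>2) = (\<Sum>i<n. (k * z i) * z i)"
    by (simp add: sum_distrib_left power2_eq_square mult.assoc)
  also have "\<dots> = (\<Sum>i<n. (\<Sum>j<n. weighted_adj f n E $$ (i, j) * z j) * z i)"
    by (intro sum.cong refl) (simp add: z)
  also have "\<dots> = (\<Sum>i<n. \<Sum>j<n. if {i, j} \<in> E then edge_weight f E i j * z i * z j else 0)"
    unfolding sum_distrib_right
    by (intro sum.cong refl) (simp add: weighted_adj_index mult_ac)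
  also have "\<dots> = 2 * (\<Sum>v\<in>V. edge_weight f E v (par v) * z v * z (par v))"
  proof (rule sum_over_edges)
    fix i j assume e: "{i, j} \<in> E"
    then have "{j, i} \<in> E" by (simp add: insert_commute)
    then show "edge_weight f E i j * z i * z j = edge_weight f E j i * z j * z i"
      using P_star_sym[OF f] edge_degree_pos[OF e] edge_degree_pos[of j i]
      by (simp add: edge_weight_def)
  qed
  also have "\<dots> \<le> \<mu> * (\<Sum>v<n. (z v)\<^sup>2)" by (rule form)
  finally show ?thesis using S by simp
qed

lemma card_branch_pos: "w \<in> children u \<Longrightarrow> card (branch w) > 0"
  using in_branch_self[of w] by (auto simp: card_gt_0_iff)

lemma sum_card_branch:
  "(\<Sum>w\<in>children u. real (card (branch w) - 1)) = real (n - 1 - card (children u))"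
proof -
  have "(\<Sum>w\<in>children u. card (branch w) - 1) + card (children u) = (\<Sum>w\<in>children u. card (branch w))"
  proof -
    have "(\<Sum>w\<in>children u. card (branch w)) = (\<Sum>w\<in>children u. card (branch w) - 1 + 1)"
      by (intro sum.cong refl) (use card_branch_pos in fastforce)
    then show ?thesis by (simp only: sum.distrib) simp
  qed
  then have "(\<Sum>w\<in>children u. card (branch w) - 1) = n - 1 - card (children u)"
    using card_branches by linarith
  then show ?thesis by (simp flip: of_nat_sum)
qed

lemma card_branch_le:
  assumes "w \<in> children u"
  shows "card (branch w) - 1 \<le> n - 1 - card (children u)"
proof -
  have "real (card (branch w) - 1) \<le> (\<Sum>w\<in>children u. real (card (branch w) - 1))"
    by (rule member_le_sum) (use assms in auto)
  then show ?thesis by (simp only: sum_card_branch of_nat_le_iff)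
qed

lemma edge_weight_off_root:
  assumes f: "P_star f" and v: "v \<in> V" "par v \<noteq> u"
  shows "0 \<le> edge_weight f E v (par v)"
    and "edge_weight f E v (par v) \<le> f 1 (real (n - card (children u)))"
proof -
  let ?dv = "Defs.degree E v" and ?dp = "Defs.degree E (par v)"
  define w where "w = branch_root v"
  have w: "w \<in> children u" "v \<in> branch w" using branch_root_in v by (auto simp: w_def branch_def)
  then have "v \<noteq> w" using v(2) by (auto simp: children_def)
  have pos: "?dv > 0" "?dp > 0"
    using edge_degree_pos[OF edge_par[OF v(1)]] edge_degree_pos[of "par v" v] edge_par[OF v(1)]
    by (simp_all add: insert_commute)
  then show "0 \<le> edge_weight f E v (par v)"
    using P_star_pos[OF f, of "real ?dv" "real ?dp"] by (simp add: edge_weight_def)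
  have "card (children u) \<le> n - 1"
    using card_mono[of V "children u"] root by (auto simp: children_def)
  \<comment> \<open>A branch has at most d = \<open>n - card (children u)\<close> vertices, so the
    two degrees add up to at most d + 1.\<close>
  then have le: "real ?dv + real ?dp - 1 \<le> real (n - card (children u))"
    using degree_add_le_branch[OF w \<open>v \<noteq> w\<close>] card_branch_le[OF w(1)] root by linarith
  have "edge_weight f E v (par v) \<le> f 1 (real ?dv + real ?dp - 1)"
    unfolding edge_weight_def using pos by (intro P_star_spread[OF f]) auto
  also have "\<dots> \<le> f 1 (real (n - card (children u)))"
    by (rule P_star_mono2[OF f]) (use pos le in auto)
  finally show "edge_weight f E v (par v) \<le> f 1 (real (n - card (children u)))" .
qed

lemma edge_weight_at_root:
  assumes "w \<in> children u"
  shows "edge_weight f E w (par w) = f (real (card (children w)) + 1) (real (card (children u)))"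
proof -
  have "w < n" "w \<noteq> u" "par w = u" using assms by (auto simp: children_def)
  then show ?thesis using root by (simp add: edge_weight_def degree_eq add.commute)
qed

end

section \<open>Branch estimates at the spectral radius of the double star\<close>

locale tree_versus_double_star = rooted_tree +
  fixes f :: "real \<Rightarrow> real \<Rightarrow> real" and d :: nat and x :: real
  assumes f: "P_star f" and d: "d = n - card (children u)" "d \<ge> 2" and child: "children u \<noteq> {}"
    and x: "double_star_root f n d x"
begin

abbreviation "s \<equiv> f 1 (real d)"
abbreviation "wt v \<equiv> edge_weight f E v (par v)"
abbreviation "branch_size w \<equiv> card (branch w) - 1"
text \<open>The convexity parameter of a branch: 0 if \<open>w\<close> is pendant, 1 if the branch
  holds all d - 1 edges away from \<open>u\<close>. It turns \<tau> into m * s^2 / x.\<close>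

abbreviation "share w \<equiv> real (branch_size w) / real (d - 1)"
abbreviation "\<tau> \<equiv> real (d - 1) * s\<^sup>2 / x"
text \<open>The weights, in the double star, of a pendant edge at the vertex of degree n - d
  (\<open>a\<close>) and of the central edge (\<open>b\<close>): the endpoints of the chord that
  bounds the weights of the edges at \<open>u\<close>.\<close>

abbreviation "a \<equiv> f 1 (real (n - d))"
abbreviation "b \<equiv> f (real d) (real (n - d))"

lemma card_children: "card (children u) = n - d" "n - d > 0" "d < n"
  "n - 1 - card (children u) = d - 1"
proof -
  have "card (children u) > 0" using child by (simp add: card_gt_0_iff)
  then show "card (children u) = n - d" "n - d > 0" "d < n"
    "n - 1 - card (children u) = d - 1" using d by linarith+
qed

lemma s_pos: "s > 0" using P_star_pos[OF f, of 1 "real d"] d by simp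
lemma a_pos: "a > 0" using P_star_pos[OF f, of 1 "real (n - d)"] card_children by simp
lemma a_le_b: "a \<le> b" by (rule P_star_mono[OF f]) (use d card_children in auto)

lemma x_gt: "real (d - 1) * s\<^sup>2 < x" using x by (simp add: double_star_root_def)

lemma x_pos: "x > 0" using x_gt by (smt (verit) mult_nonneg_nonneg of_nat_0_le_iff zero_le_power2)

lemma tau: "0 < \<tau>" "\<tau> < 1"
  using x_pos x_gt s_pos d by auto

text \<open>The quadratic solved for its second factor. The double star has n - d - 1 pendant
  branches, worth a^2 each, and one full branch, worth b^2 / (1 - \<tau>); this form matches the sum
  of the chord bounds.\<close>

lemma x_eq: "x = real (n - d) * a\<^sup>2 + (b\<^sup>2 / (1 - \<tau>) - a\<^sup>2)"
proof -
  have "(x - real (d - 1) * s\<^sup>2) * (x - real (n - d - 1) * a\<^sup>2) = b\<^sup>2 * x"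
    using x by (simp add: double_star_root_def)
  then have "x - real (n - d - 1) * a\<^sup>2 = b\<^sup>2 * x / (x - real (d - 1) * s\<^sup>2)"
    using x_gt by (simp add: field_simps)
  also have "\<dots> = b\<^sup>2 / (1 - \<tau>)" using x_pos x_gt by (simp add: field_simps)
  also have "real (n - d - 1) = real (n - d) - 1" using card_children by simp
  finally show ?thesis by (simp add: algebra_simps)
qed

lemma size_le: "w \<in> children u \<Longrightarrow> branch_size w \<le> d - 1"
  using card_branch_le card_children by simp

lemma share: "w \<in> children u \<Longrightarrow> 0 \<le> share w \<and> share w \<le> 1"
  using size_le[of w] d by simp

lemma share_tau: "share w * \<tau> = real (branch_size w) * s\<^sup>2 / x"
  using d by simp

lemma sum_share: "(\<Sum>w\<in>children u. share w) = 1"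
  unfolding sum_divide_distrib[symmetric] sum_card_branch card_children(4) using d by simp

lemma size_small: "w \<in> children u \<Longrightarrow> real (branch_size w) * s\<^sup>2 < x"
proof -
  assume "w \<in> children u"
  then have "real (branch_size w) * s\<^sup>2 \<le> real (d - 1) * s\<^sup>2"
    using size_le by (intro mult_right_mono) auto
  then show ?thesis using x_gt by linarith
qed

lemma gain:
  assumes w: "w \<in> children u"
  shows "sqrt x * branch_gain s (sqrt x) w \<le> real (branch_size w) * s\<^sup>2"
    and "card (children w) < branch_size w \<Longrightarrow> sqrt x * branch_gain s (sqrt x) w < real (branch_size w) * s\<^sup>2"
    and "branch_gain s (sqrt x) w < sqrt x"
proof -
  note * = gain_bound[of "real (card (children w))" "real (branch_size w)" "s\<^sup>2" "sqrt x"]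
  show 1: "sqrt x * branch_gain s (sqrt x) w \<le> real (branch_size w) * s\<^sup>2"
    using *(1) card_branch_split(1)[OF w] size_small[OF w] s_pos x_pos by (simp add: branch_gain_def)
  show "card (children w) < branch_size w \<Longrightarrow> sqrt x * branch_gain s (sqrt x) w < real (branch_size w) * s\<^sup>2"
    using *(2) card_branch_split(1)[OF w] size_small[OF w] s_pos x_pos by (simp add: branch_gain_def)
  have "sqrt x * branch_gain s (sqrt x) w < sqrt x * sqrt x" using 1 size_small[OF w] x_pos by simp
  then show "branch_gain s (sqrt x) w < sqrt x"
    using x_pos by (simp only: mult_less_cancel_left_pos real_sqrt_gt_0_iff)
qed

text \<open>The degree of \<open>w\<close> is at most m + 1, which divides the interval from 1 to d
  in the ratio given by \<open>share w\<close>; convexity of f in its first argument does the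
  rest.\<close>

lemma wt_root_le:
  assumes w: "w \<in> children u"
  shows "0 < wt w" "wt w \<le> (1 - share w) * a + share w * b"
proof -
  show "0 < wt w" unfolding edge_weight_at_root[OF w]
    using P_star_pos[OF f] card_children by simp
  have "wt w \<le> f (real (branch_size w) + 1) (real (n - d))"
    unfolding edge_weight_at_root[OF w] card_children(1)
    by (rule P_star_mono[OF f]) (use card_branch_split(1)[OF w] card_children in auto)
  also have "real (branch_size w) + 1 = (1 - share w) *\<^sub>R 1 + share w *\<^sub>R real d"
  proof -
    have "real d - 1 = real (d - 1)" "real (d - 1) \<noteq> 0" using d(2) by auto
    then have "share w * (real d - 1) = real (branch_size w)" by simp
    moreover have "t * (y - 1) = m \<Longrightarrow> m + 1 = (1 - t) *\<^sub>R 1 + t *\<^sub>R y" for t y m :: real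
      by (auto simp: algebra_simps)
    ultimately show ?thesis by blast
  qed
  also have "f \<dots> (real (n - d)) \<le> (1 - share w) * a + share w * b"
    by (rule convex_onD[OF P_star_convex[OF f]]) (use share[OF w] d(2) card_children(2) in auto)
  finally show "wt w \<le> (1 - share w) * a + share w * b" .
qed

text \<open>Three estimates are chained: the gain is at most that of a star, the weight lies below
  its chord, and the perspective function lies below its chord. The first is strict if some vertex
  of the branch is neither \<open>w\<close> nor a child of \<open>w\<close>, the third if 0 <
  \<open>share w\<close> < 1.\<close>

lemma branch_term_le:
  assumes w: "w \<in> children u"
  shows "sqrt x * ((wt w)\<^sup>2 / (sqrt x - branch_gain s (sqrt x) w))
      \<le> a\<^sup>2 + share w * (b\<^sup>2 / (1 - \<tau>) - a\<^sup>2)"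
    and "card (children w) < branch_size w \<or> 0 < branch_size w \<and> branch_size w < d - 1 \<Longrightarrow>
      sqrt x * ((wt w)\<^sup>2 / (sqrt x - branch_gain s (sqrt x) w))
      < a\<^sup>2 + share w * (b\<^sup>2 / (1 - \<tau>) - a\<^sup>2)"
proof -
  define G where "G = sqrt x * branch_gain s (sqrt x) w"
  have Gx: "G < x" using gain(1)[OF w] size_small[OF w] by (simp add: G_def)
  have e: "sqrt x * ((wt w)\<^sup>2 / (sqrt x - branch_gain s (sqrt x) w)) = (wt w)\<^sup>2 / (1 - G / x)"
  proof -
    have "1 - G / x = (sqrt x - branch_gain s (sqrt x) w) / sqrt x"
      using x_pos by (simp add: G_def field_simps)
    then show ?thesis by simp
  qed
  have m: "1 - share w * \<tau> > 0"
    unfolding share_tau using size_small[OF w] x_pos by simp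
  have G: "1 - share w * \<tau> \<le> 1 - G / x"
    unfolding share_tau using gain(1)[OF w] x_pos by (simp add: G_def divide_right_mono)
  have W: "(wt w)\<^sup>2 \<le> ((1 - share w) * a + share w * b)\<^sup>2"
    using wt_root_le[OF w] by (intro power_mono) auto
  have 1: "(wt w)\<^sup>2 / (1 - G / x) \<le> (wt w)\<^sup>2 / (1 - share w * \<tau>)"
    using G m by (intro divide_left_mono mult_pos_pos) auto
  have 2: "(wt w)\<^sup>2 / (1 - share w * \<tau>) \<le> ((1 - share w) * a + share w * b)\<^sup>2 / (1 - share w * \<tau>)"
    using W m by (intro divide_right_mono) auto
  note persp = perspective_square_convex[of "share w" \<tau> a b]
  have 3: "((1 - share w) * a + share w * b)\<^sup>2 / (1 - share w * \<tau>)
      \<le> a\<^sup>2 + share w * (b\<^sup>2 / (1 - \<tau>) - a\<^sup>2)"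
    by (rule persp(1)) (use share[OF w] tau in linarith)+
  show "sqrt x * ((wt w)\<^sup>2 / (sqrt x - branch_gain s (sqrt x) w))
      \<le> a\<^sup>2 + share w * (b\<^sup>2 / (1 - \<tau>) - a\<^sup>2)"
    unfolding e using 1 2 3 by linarith
  assume "card (children w) < branch_size w \<or> 0 < branch_size w \<and> branch_size w < d - 1"
  then show "sqrt x * ((wt w)\<^sup>2 / (sqrt x - branch_gain s (sqrt x) w))
      < a\<^sup>2 + share w * (b\<^sup>2 / (1 - \<tau>) - a\<^sup>2)"
  proof
    assume "card (children w) < branch_size w"
    then have "1 - share w * \<tau> < 1 - G / x"
      unfolding share_tau using gain(2)[OF w] x_pos by (simp add: G_def divide_strict_right_mono)
    then have "(wt w)\<^sup>2 / (1 - G / x) < (wt w)\<^sup>2 / (1 - share w * \<tau>)"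
      using m wt_root_le(1)[OF w] by (intro divide_strict_left_mono mult_pos_pos) auto
    then show ?thesis unfolding e using 2 3 by linarith
  next
    assume "0 < branch_size w \<and> branch_size w < d - 1"
    then have "0 < share w" "share w < 1" by auto
    then have "((1 - share w) * a + share w * b)\<^sup>2 / (1 - share w * \<tau>)
      < a\<^sup>2 + share w * (b\<^sup>2 / (1 - \<tau>) - a\<^sup>2)"
      by (intro persp(2)) (use share[OF w] tau a_pos a_le_b in linarith)+
    then show ?thesis unfolding e using 1 2 by linarith
  qed
qed

text \<open>The bounds are affine in the share and the shares add up to 1, so the total does not
  depend on the tree.\<close>

lemma sum_bounds: "(\<Sum>w\<in>children u. a\<^sup>2 + share w * (b\<^sup>2 / (1 - \<tau>) - a\<^sup>2)) = x"
proof -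
  have "(\<Sum>w\<in>children u. a\<^sup>2 + share w * (b\<^sup>2 / (1 - \<tau>) - a\<^sup>2))
      = real (n - d) * a\<^sup>2 + (\<Sum>w\<in>children u. share w) * (b\<^sup>2 / (1 - \<tau>) - a\<^sup>2)"
    unfolding sum.distrib sum_distrib_right by (simp add: card_children)
  also have "\<dots> = x" unfolding sum_share using x_eq by simp
  finally show ?thesis .
qed

lemma eigenvalue_le:
  assumes ev: "eigenvalue (weighted_adj f n E) k"
  shows "k \<le> sqrt x"
proof (rule eigenvalue_form_le[OF f ev], rule tree_form[where s = s])
  have "sqrt x * (\<Sum>w\<in>children u. (wt w)\<^sup>2 / (sqrt x - branch_gain s (sqrt x) w)) \<le> x"
    unfolding sum_distrib_left
    by (rule order_trans[OF sum_mono[OF branch_term_le(1)]]) (simp_all only: sum_bounds order_refl)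
  also have "x = sqrt x * sqrt x" using x_pos by simp
  finally show "(\<Sum>w\<in>children u. (wt w)\<^sup>2 / (sqrt x - branch_gain s (sqrt x) w)) \<le> sqrt x"
    using x_pos by (simp only: mult_le_cancel_left_pos real_sqrt_gt_0_iff)
qed (use edge_weight_off_root[OF f] d x_pos s_pos size_small gain(3) in auto)

text \<open>Without a strict term every branch is a star with 0 or d - 1 edges. As the shares add up
  to 1, exactly one branch is full, and then every vertex not adjacent to \<open>u\<close> hangs
  from its top, contrary to the assumption.\<close>

lemma strict_branch:
  assumes "\<not> (\<exists>w\<in>children u. \<forall>v\<in>V. par v \<noteq> u \<longrightarrow> par v = w)"
  shows "\<exists>w\<in>children u. card (children w) < branch_size w \<or> 0 < branch_size w \<and> branch_size w < d - 1"
proof (rule ccontr)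
  assume no: "\<not> ?thesis"
  have full: "card (children w) = branch_size w" if "w \<in> children u" for w
    using no card_branch_split(1)[OF that] that by force
  have ends: "branch_size w = 0 \<or> branch_size w = d - 1" if "w \<in> children u" for w
    using no size_le[OF that] that by force
  have "\<exists>w\<in>children u. branch_size w \<noteq> 0"
  proof (rule ccontr)
    assume "\<not> ?thesis"
    then have "(\<Sum>w\<in>children u. share w) = 0" by simp
    then show False using sum_share by simp
  qed
  then obtain w where w0: "w \<in> children u" "branch_size w \<noteq> 0" by auto
  then have w: "w \<in> children u" "branch_size w = d - 1" using ends[OF w0(1)] by simp_all
  have "par v = w" if v: "v \<in> V" "par v \<noteq> u" for v
  proof -
    define w' where "w' = branch_root v"
    have w': "w' \<in> children u" "v \<in> branch w'" using branch_root_in v by (auto simp: w'_def branch_def)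
    have vw': "v \<noteq> w'" using w' v by (auto simp: children_def)
    have "children w' \<noteq> {}" using branch_has_child[OF w' vw'] .
    then have "branch_size w' \<noteq> 0" using full[OF w'(1)] by (auto simp: card_eq_0_iff)
    then have m': "branch_size w' = d - 1" using ends[OF w'(1)] by simp
    have "w' = w"
    proof (rule ccontr)
      assume ne: "w' \<noteq> w"
      have "(\<Sum>y\<in>{w, w'}. share y) \<le> (\<Sum>y\<in>children u. share y)"
        by (rule sum_mono2) (use w w' share in auto)
      moreover have "share w = 1" "share w' = 1" unfolding w(2) m' using d(2) by simp_all
      moreover have "(\<Sum>y\<in>{w, w'}. share y) = share w + share w'" using ne by simp
      ultimately show False unfolding sum_share by linarith
    qed
    have "children w = branch w - {w}"
      by (rule card_subset_eq) (use children_in_branch[OF w(1)] full[OF w(1)] in_branch_self[OF w(1)] in auto)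
    then have "v \<in> children w" using w' \<open>w' = w\<close> vw' by auto
    then show ?thesis by (simp add: children_def)
  qed
  with assms w(1) show False by blast
qed

text \<open>The sum in tree_form is strictly less than the bound at sqrt x, hence by continuity also
  at some smaller positive number.\<close>
lemma eigenvalue_less:
  assumes ev: "eigenvalue (weighted_adj f n E) k"
    and ns: "\<not> (\<exists>w\<in>children u. \<forall>v\<in>V. par v \<noteq> u \<longrightarrow> par v = w)"
  shows "k < sqrt x"
proof -
  have "sqrt x * (\<Sum>w\<in>children u. (wt w)\<^sup>2 / (sqrt x - branch_gain s (sqrt x) w))
      < (\<Sum>w\<in>children u. a\<^sup>2 + share w * (b\<^sup>2 / (1 - \<tau>) - a\<^sup>2))"
    unfolding sum_distrib_left
    by (rule sum_strict_mono_ex1) (use branch_term_le strict_branch[OF ns] in auto)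
  also have "\<dots> = sqrt x * sqrt x" unfolding sum_bounds using x_pos by simp
  finally have lt: "(\<Sum>w\<in>children u. (wt w)\<^sup>2 / (sqrt x - branch_gain s (sqrt x) w)) < sqrt x"
    using x_pos by (simp only: mult_less_cancel_left_pos real_sqrt_gt_0_iff)
  have den: "y - (real (branch_size w) - real (card (children w))) * s\<^sup>2 / y \<noteq> 0" if "w \<in> children u" "y = sqrt x" for w y
  proof -
    have "(real (branch_size w) - real (card (children w))) * s\<^sup>2 \<le> real (branch_size w) * s\<^sup>2"
      by (intro mult_right_mono) auto
    also have "\<dots> < y * y" using size_small[OF that(1)] x_pos that(2) by simp
    finally show ?thesis using that(2) x_pos by (simp add: field_simps)
  qed
  have cont_gain: "((\<lambda>y. branch_gain s y w) \<longlongrightarrow> branch_gain s (sqrt x) w) (at_left (sqrt x))"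
    if w: "w \<in> children u" for w
    unfolding branch_gain_def
    by (intro tendsto_intros) (use den[OF w] x_pos in auto)
  have ev_gain: "\<forall>\<^sub>F y in at_left (sqrt x). \<forall>w\<in>children u. branch_gain s y w < y"
  proof (rule eventually_ball_finite[OF finite_children], rule ballI)
    fix w assume w: "w \<in> children u"
    have "((\<lambda>y. y - branch_gain s y w) \<longlongrightarrow> sqrt x - branch_gain s (sqrt x) w) (at_left (sqrt x))"
      by (intro tendsto_intros cont_gain w)
    then have "\<forall>\<^sub>F y in at_left (sqrt x). 0 < y - branch_gain s y w"
      by (rule order_tendstoD(1)) (use gain(3)[OF w] in simp)
    then show "\<forall>\<^sub>F y in at_left (sqrt x). branch_gain s y w < y" by simp
  qed
  have "((\<lambda>y. y - (\<Sum>w\<in>children u. (wt w)\<^sup>2 / (y - branch_gain s y w)))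
      \<longlongrightarrow> sqrt x - (\<Sum>w\<in>children u. (wt w)\<^sup>2 / (sqrt x - branch_gain s (sqrt x) w))) (at_left (sqrt x))"
    by (intro tendsto_intros cont_gain) (use gain(3) in force)+
  then have ev_sum: "\<forall>\<^sub>F y in at_left (sqrt x). 0 < y - (\<Sum>w\<in>children u. (wt w)\<^sup>2 / (y - branch_gain s y w))"
    by (rule order_tendstoD(1)) (use lt in simp)
  have "((\<lambda>y. y\<^sup>2) \<longlongrightarrow> (sqrt x)\<^sup>2) (at_left (sqrt x))" by (intro tendsto_intros)
  then have ev_sq: "\<forall>\<^sub>F y in at_left (sqrt x). real (d - 1) * s\<^sup>2 < y\<^sup>2"
    by (rule order_tendstoD(1)) (use x_gt x_pos in simp)
  have ev_pos: "\<forall>\<^sub>F y in at_left (sqrt x). 0 < y \<and> y < sqrt x"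
    using eventually_at_left_real[of 0 "sqrt x"] x_pos by simp
  \<comment> \<open>The hypotheses of \<open>tree_form\<close> are needed at one number below
    \<open>sqrt x\<close>. Each holds eventually on the left of \<open>sqrt x\<close>, so some
    \<open>y\<close> satisfies all of them.\<close>
  have "\<exists>y. (\<forall>w\<in>children u. branch_gain s y w < y) \<and>
      0 < y - (\<Sum>w\<in>children u. (wt w)\<^sup>2 / (y - branch_gain s y w)) \<and>
      real (d - 1) * s\<^sup>2 < y\<^sup>2 \<and> 0 < y \<and> y < sqrt x"
    by (rule eventually_happens'[OF _ eventually_conj[OF ev_gain
          eventually_conj[OF ev_sum eventually_conj[OF ev_sq ev_pos]]]]) simp
  then obtain y where y: "\<And>w. w \<in> children u \<Longrightarrow> branch_gain s y w < y"
    "0 < y - (\<Sum>w\<in>children u. (wt w)\<^sup>2 / (y - branch_gain s y w))"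
    "real (d - 1) * s\<^sup>2 < y\<^sup>2" "0 < y" "y < sqrt x" by blast
  have "k \<le> y"
  proof (rule eigenvalue_form_le[OF f ev], rule tree_form[where s = s])
    fix w assume "w \<in> children u"
    then have "real (branch_size w) * s\<^sup>2 \<le> real (d - 1) * s\<^sup>2"
      using size_le by (intro mult_right_mono) auto
    then show "real (branch_size w) * s\<^sup>2 < y\<^sup>2" using y(3) by linarith
  qed (use edge_weight_off_root[OF f] d s_pos y in auto)
  then show ?thesis using y(5) by linarith
qed

end

section \<open>Spectra of double stars\<close>

lemma larger_root_exists:
  fixes A B c :: real
  assumes "A \<ge> 0" "B \<ge> 0" "A > 0 \<or> B > 0" "c > 0"
  shows "\<exists>x. x > A \<and> x > B \<and> (x - A) * (x - B) = c\<^sup>2 * x"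
proof -
  define g where "g x = (x - A) * (x - B) - c\<^sup>2 * x" for x
  have "max A B > 0" using assms by auto
  then have neg: "g (max A B) < 0" using assms by (auto simp: g_def max_def)
  \<comment> \<open>This point is the sum of the two roots of the quadratic, where its value is the
    constant term \<open>A * B\<close>.\<close>
  have "g (A + B + c\<^sup>2) = A * B" by (simp add: g_def algebra_simps)
  then have pos: "g (A + B + c\<^sup>2) \<ge> 0" using assms by simp
  have le: "max A B \<le> A + B + c\<^sup>2" using assms by (auto simp: max_def add_nonneg_nonneg)
  have "continuous_on {max A B..A + B + c\<^sup>2} g" unfolding g_def by (intro continuous_intros)
  then obtain x where x: "max A B \<le> x" "g x = 0"
    using IVT'[of g "max A B" 0 "A + B + c\<^sup>2"] neg pos le by auto
  then have "x \<noteq> max A B" using neg by auto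
  then show ?thesis using x by (intro exI[of _ x]) (auto simp: g_def)
qed

text \<open>With g t = (t - A) * (t - B) - c^2 * t, the identity x * g y - y * g x = (y - x) * (x *
  y - A * B) shows that g is nonnegative beyond the larger root.\<close>

lemma less_larger_root:
  fixes A B c x y :: real
  assumes "A \<ge> 0" "B \<ge> 0" "x > A" "x > B" "(x - A) * (x - B) = c\<^sup>2 * x" "(y - A) * (y - B) < c\<^sup>2 * y"
  shows "y < x"
proof (rule ccontr)
  assume "\<not> y < x"
  then have y: "y \<ge> x" "x > 0" using assms by auto
  have "x * y \<ge> A * B" using assms y by (intro mult_mono) auto
  then have "(y - x) * (x * y - A * B) \<ge> 0" using y by simp
  also have "(y - x) * (x * y - A * B) = (y - A) * (y - B) * x - y * ((x - A) * (x - B))"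
    by (simp add: algebra_simps)
  also have "\<dots> = ((y - A) * (y - B) - c\<^sup>2 * y) * x" unfolding assms(5) by (simp add: algebra_simps)
  finally show False using assms(6) y by (simp add: zero_le_mult_iff)
qed

lemma double_star_root_exists:
  assumes f: "P_star f" and "1 \<le> d" "d < n" "3 \<le> n"
  shows "\<exists>x. double_star_root f n d x"
proof -
  have pos: "f 1 (real d) > 0" "f 1 (real (n - d)) > 0" "f (real d) (real (n - d)) > 0"
    using P_star_pos[OF f] assms by simp_all
  have "d - 1 > 0 \<or> n - d - 1 > 0" using assms by linarith
  then have "real (d - 1) * (f 1 (real d))\<^sup>2 > 0 \<or> real (n - d - 1) * (f 1 (real (n - d)))\<^sup>2 > 0"
    using pos by (auto simp del: of_nat_diff)
  from larger_root_exists[OF _ _ this pos(3)] show ?thesis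
    unfolding double_star_root_def by auto
qed

lemma double_star_root_sym:
  assumes f: "P_star f" and "1 \<le> d" "d < n" and x: "double_star_root f n d x"
  shows "double_star_root f n (n - d) x"
proof -
  have "n - (n - d) = d" using assms by simp
  moreover have "f (real (n - d)) (real d) = f (real d) (real (n - d))"
    by (rule P_star_sym[OF f]) (use assms in auto)
  ultimately show ?thesis using x unfolding double_star_root_def by (simp add: mult.commute)
qed

text \<open>The quadratic for \<open>d\<close> is shown to be negative at the root \<open>y\<close>
  for \<open>Suc d\<close>. The assumption on \<open>n\<close> keeps \<open>Suc d\<close> on the
  smaller side, which fixes the direction of all comparisons; primed letters belong to
  \<open>Suc d\<close>.\<close>

lemma double_star_root_Suc:
  assumes f: "P_star f" and d: "1 \<le> d" "2 * Suc d \<le> n"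
    and x: "double_star_root f n d x" and y: "double_star_root f n (Suc d) y"
  shows "y < x"
proof -
  define r where "r = real d"
  define N where "N = real n"
  have r: "r \<ge> 1" "2 * (r + 1) \<le> N" using d by (auto simp: r_def N_def)
  have conv: "real (d - 1) = r - 1" "real (n - d - 1) = N - r - 1" "real (n - d) = N - r" "real d = r"
    "real (Suc d - 1) = r" "real (n - Suc d - 1) = N - r - 2" "real (n - Suc d) = N - r - 1"
    "real (Suc d) = r + 1"
    using d by (auto simp: r_def N_def)
  define p where "p = f 1 r"
  define q where "q = f 1 (N - r)"
  define p' where "p' = f 1 (r + 1)"
  define q' where "q' = f 1 (N - r - 1)"
  define c where "c = f r (N - r)"
  define c' where "c' = f (r + 1) (N - r - 1)"
  have X: "x > (r - 1) * p\<^sup>2" "x > (N - r - 1) * q\<^sup>2"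
    "(x - (r - 1) * p\<^sup>2) * (x - (N - r - 1) * q\<^sup>2) = c\<^sup>2 * x"
    using x unfolding double_star_root_def conv p_def q_def c_def by auto
  have Y: "y > r * p'\<^sup>2" "y > (N - r - 2) * q'\<^sup>2"
    "(y - r * p'\<^sup>2) * (y - (N - r - 2) * q'\<^sup>2) = c'\<^sup>2 * y"
    using y unfolding double_star_root_def conv p'_def q'_def c'_def by auto
  have pos: "0 < p" "0 < q'" "0 < c'" unfolding p_def q'_def c'_def using r by (auto intro!: P_star_pos[OF f])
  have mono: "p \<le> p'" "p' \<le> q'" "q' \<le> q"
    unfolding p_def q_def p'_def q'_def using r by (auto intro!: P_star_mono2[OF f])
  have cc: "c' \<le> c"
    unfolding c_def c'_def by (rule P_star_apart[OF f]) (use r in auto)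
  have inc: "p' - p \<le> q - q'"
  proof -
    have "f (r + 1) 1 - f r 1 \<le> f (N - r - 1 + 1) 1 - f (N - r - 1) 1"
      by (rule convex_on_increment_mono[OF P_star_convex[OF f]]) (use r in auto)
    moreover have "f t 1 = f 1 t" if "t > 0" for t by (rule P_star_sym[OF f]) (use that in auto)
    ultimately show ?thesis using r by (simp add: p_def q_def p'_def q'_def)
  qed
  have sq: "p'\<^sup>2 - p\<^sup>2 \<le> q\<^sup>2 - q'\<^sup>2"
  proof -
    have "(p' - p) * (p' + p) \<le> (q - q') * (q + q')"
      by (rule mult_mono) (use inc mono pos in auto)
    then show ?thesis by (simp add: power2_eq_square algebra_simps)
  qed
  have sq0: "p\<^sup>2 \<le> p'\<^sup>2" "p'\<^sup>2 \<le> q'\<^sup>2" "q'\<^sup>2 \<le> q\<^sup>2" "p'\<^sup>2 > 0"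
    using mono pos by (auto intro!: power_mono)
  \<comment> \<open>Passing from \<open>d\<close> to \<open>Suc d\<close> raises the contribution of
    the smaller star by \<alpha> and lowers that of the larger star by \<beta>. Convexity makes the
    steps of the weight larger at larger degrees, hence \<alpha> \<le> \<beta>.\<close>
  define \<alpha> where "\<alpha> = r * p'\<^sup>2 - (r - 1) * p\<^sup>2"
  define \<beta> where "\<beta> = (N - r - 1) * q\<^sup>2 - (N - r - 2) * q'\<^sup>2"
  have a1: "\<alpha> = p'\<^sup>2 + (r - 1) * (p'\<^sup>2 - p\<^sup>2)" by (simp add: \<alpha>_def algebra_simps)
  have b1: "\<beta> = q\<^sup>2 + (N - r - 2) * (q\<^sup>2 - q'\<^sup>2)" by (simp add: \<beta>_def algebra_simps)
  have \<alpha>: "\<alpha> > 0" unfolding a1 using sq0 r by (intro add_pos_nonneg mult_nonneg_nonneg) auto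
  have \<alpha>\<beta>: "\<alpha> \<le> \<beta>"
    unfolding a1 b1 using sq0 sq r by (intro add_mono mult_mono) auto
  define A where "A = y - r * p'\<^sup>2"
  define B where "B = y - (N - r - 2) * q'\<^sup>2"
  have "r * p'\<^sup>2 \<le> (N - r - 2) * q'\<^sup>2" using sq0 r by (intro mult_mono) auto
  then have BA: "B \<le> A" by (simp add: A_def B_def)
  have A: "A > 0" "B > 0" using Y by (auto simp: A_def B_def)
  \<comment> \<open>Since B \<le> A, moving the factors A and B further apart by \<alpha> strictly
    lowers their product.\<close>
  have "(A + \<alpha>) * (B - \<beta>) \<le> (A + \<alpha>) * (B - \<alpha>)"
    using \<alpha>\<beta> \<alpha> A by (intro mult_left_mono) auto
  also have "\<dots> = A * B - \<alpha> * (A - B) - \<alpha> * \<alpha>" by (simp add: algebra_simps)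
  also have "\<dots> < A * B"
  proof -
    have "\<alpha> * (A - B) \<ge> 0" "\<alpha> * \<alpha> > 0" using \<alpha> BA by auto
    then show ?thesis by linarith
  qed
  also have "\<dots> = c'\<^sup>2 * y" using Y by (simp add: A_def B_def)
  also have "\<dots> \<le> c\<^sup>2 * y"
  proof (rule mult_right_mono)
    show "c'\<^sup>2 \<le> c\<^sup>2" using cc pos by (intro power_mono) auto
    have "0 \<le> r * p'\<^sup>2" using r by simp
    then show "0 \<le> y" using Y(1) by linarith
  qed
  finally have "(y - (r - 1) * p\<^sup>2) * (y - (N - r - 1) * q\<^sup>2) < c\<^sup>2 * y"
    by (simp add: A_def B_def \<alpha>_def \<beta>_def)
  then show ?thesis
    by (intro less_larger_root[OF _ _ X]) (use r in auto)
qed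

lemma double_star_root_antimono:
  assumes f: "P_star f" and "1 \<le> d" "d < e" "2 * e \<le> n"
    and x: "double_star_root f n d x" and y: "double_star_root f n e y"
  shows "y < x"
  using \<open>d < e\<close> \<open>2 * e \<le> n\<close> y
proof (induction "e - Suc d" arbitrary: e y)
  case 0
  then have "e = Suc d" by simp
  then show ?case using double_star_root_Suc[OF f \<open>1 \<le> d\<close> _ x] 0 by simp
next
  case (Suc k)
  then obtain e' where e': "e = Suc e'" "d < e'" by (cases e) auto
  obtain z where z: "double_star_root f n e' z"
    using double_star_root_exists[OF f, of e' n] Suc e' \<open>1 \<le> d\<close> by auto
  have "y < z" by (rule double_star_root_Suc[OF f _ _ z]) (use e' Suc \<open>1 \<le> d\<close> in auto)
  also have "z < x" using Suc.hyps(1)[of e'] Suc.hyps(2) e' Suc.prems z by auto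
  finally show ?case .
qed

section \<open>Explicit eigenvectors of the double star and the star\<close>

lemma weighted_adj_row_sum:
  assumes "i < n" "{j. {j, i} \<in> E} = N" "N \<subseteq> {..<n}"
  shows "(\<Sum>j<n. weighted_adj f n E $$ (i, j) * y j) = (\<Sum>j\<in>N. edge_weight f E i j * y j)"
proof -
  have "(\<Sum>j<n. weighted_adj f n E $$ (i, j) * y j) = (\<Sum>j<n. if j \<in> N then edge_weight f E i j * y j else 0)"
    using assms by (intro sum.cong refl) (auto simp: weighted_adj_index insert_commute)
  also have "\<dots> = (\<Sum>j\<in>N. edge_weight f E i j * y j)"
    using assms(3) by (simp add: sum.If_cases Int_absorb1)
  finally show ?thesis .
qed

lemma double_star_neighbours:
  assumes "1 \<le> d" "d < n"
  shows "{j. {j, 0} \<in> double_star d n} = insert 1 {2..d}"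
    and "{j. {j, 1} \<in> double_star d n} = insert 0 {d<..<n}"
    and "2 \<le> i \<Longrightarrow> i \<le> d \<Longrightarrow> {j. {j, i} \<in> double_star d n} = {0}"
    and "2 \<le> i \<Longrightarrow> d < i \<Longrightarrow> i < n \<Longrightarrow> {j. {j, i} \<in> double_star d n} = {1}"
  using assms by (auto simp: double_star_def doubleton_eq_iff)

lemma double_star_degree:
  assumes "1 \<le> d" "d < n"
  shows "Defs.degree (double_star d n) 0 = d"
    and "Defs.degree (double_star d n) 1 = n - d"
    and "2 \<le> i \<Longrightarrow> i < n \<Longrightarrow> Defs.degree (double_star d n) i = 1"
proof -
  show "Defs.degree (double_star d n) 0 = d" "Defs.degree (double_star d n) 1 = n - d"
    using assms unfolding Defs.degree_def double_star_neighbours[OF assms] by (auto simp: card_insert_if)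
  show "2 \<le> i \<Longrightarrow> i < n \<Longrightarrow> Defs.degree (double_star d n) i = 1"
    using double_star_neighbours(3,4)[OF assms, of i] unfolding Defs.degree_def
    by (cases "i \<le> d") auto
qed

lemma rho_f_double_star:
  assumes f: "P_star f" and d: "1 \<le> d" "d < n" "2 \<le> n" and x: "double_star_root f n d x"
  shows "rho_f f n (double_star d n) = sqrt x"
proof -
  let ?E = "double_star d n"
  define p where "p = f 1 (real d)"
  define q where "q = f 1 (real (n - d))"
  define c where "c = f (real d) (real (n - d))"
  define A where "A = real (d - 1) * p\<^sup>2"
  define B where "B = real (n - d - 1) * q\<^sup>2"
  have X: "x > A" "x > B" "(x - A) * (x - B) = c\<^sup>2 * x"
    using x by (auto simp: double_star_root_def A_def B_def p_def q_def c_def)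
  have "A \<ge> 0" by (simp add: A_def)
  then have x0: "x > 0" using X by linarith
  define l where "l = sqrt x"
  have l: "l > 0" "l * l = x" using x0 by (auto simp: l_def)
  have pos: "p > 0" "q > 0" "c > 0"
    unfolding p_def q_def c_def using d by (auto intro!: P_star_pos[OF f])
  have pendant: "f (real d) 1 = p" "f (real (n - d)) 1 = q" "f (real (n - d)) (real d) = c"
    unfolding p_def q_def c_def using d by (auto intro!: P_star_sym[OF f])
  \<comment> \<open>The leaf rows force each leaf value to be its weight times the centre value over
    \<open>l\<close>. Starting from c * l at vertex 0, the row of 0 yields x - A at vertex 1; the
    row of 1 is then the quadratic for \<open>x\<close>. All entries are positive, so the eigenvalue
    is the largest one.\<close>
  define y where "y i = (if i = 0 then c * l else if i = 1 then x - A
    else if i \<le> d then p * c else q * (x - A) / l)" for i :: nat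
  note deg = double_star_degree[OF d(1,2)]
  note nb = double_star_neighbours[OF d(1,2)]
  have ypos: "y i > 0" for i using pos l X by (simp add: y_def)
  have eq: "(\<Sum>j<n. weighted_adj f n ?E $$ (i, j) * y j) = l * y i" if i: "i < n" for i
  proof -
    consider "i = 0" | "i = 1" | "2 \<le> i" "i \<le> d" | "2 \<le> i" "d < i" by linarith
    then show ?thesis
    proof cases
      case 1
      have "(\<Sum>j<n. weighted_adj f n ?E $$ (i, j) * y j) = (\<Sum>j\<in>insert 1 {2..d}. edge_weight f ?E 0 j * y j)"
        unfolding 1 by (rule weighted_adj_row_sum[OF _ nb(1)]) (use d in auto)
      also have "\<dots> = c * (x - A) + (\<Sum>j\<in>{2..d}. p * (p * c))"
      proof -
        have "edge_weight f ?E 0 j * y j = p * (p * c)" if "j \<in> {2..d}" for j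
          using that d deg(3)[of j] by (simp add: edge_weight_def deg(1) pendant y_def)
        then have "(\<Sum>j\<in>{2..d}. edge_weight f ?E 0 j * y j) = (\<Sum>j\<in>{2..d}. p * (p * c))"
          by (intro sum.cong refl)
        moreover have "edge_weight f ?E 0 1 * y 1 = c * (x - A)"
          by (simp only: edge_weight_def deg c_def) (simp add: y_def)
        ultimately show ?thesis by (subst sum.insert) auto
      qed
      also have "\<dots> = c * (x - A) + c * A"
        using d by (simp add: A_def power2_eq_square)
      also have "\<dots> = l * y i" using 1 l by (simp add: y_def algebra_simps)
      finally show ?thesis .
    next
      case 2
      have "(\<Sum>j<n. weighted_adj f n ?E $$ (i, j) * y j) = (\<Sum>j\<in>insert 0 {d<..<n}. edge_weight f ?E 1 j * y j)"
        unfolding 2 by (rule weighted_adj_row_sum[OF _ nb(2)]) (use d in auto)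
      also have "\<dots> = c * (c * l) + (\<Sum>j\<in>{d<..<n}. q * (q * (x - A) / l))"
      proof -
        have "edge_weight f ?E 1 j * y j = q * (q * (x - A) / l)" if "j \<in> {d<..<n}" for j
        proof -
          have j: "2 \<le> j" "d < j" "j < n" using that d by auto
          then have "edge_weight f ?E 1 j = q"
            by (simp only: edge_weight_def deg(2) deg(3)[OF j(1,3)] of_nat_1 pendant)
          then show ?thesis using j by (simp add: y_def)
        qed
        then have "(\<Sum>j\<in>{d<..<n}. edge_weight f ?E 1 j * y j) = (\<Sum>j\<in>{d<..<n}. q * (q * (x - A) / l))"
          by (intro sum.cong refl)
        moreover have "edge_weight f ?E 1 0 * y 0 = c * (c * l)"
          by (simp only: edge_weight_def deg pendant) (simp add: y_def)
        ultimately show ?thesis by (subst sum.insert) auto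
      qed
      also have "\<dots> = c\<^sup>2 * l + B * (x - A) / l"
        using d by (simp add: B_def power2_eq_square)
      also have "\<dots> = (c\<^sup>2 * x + B * (x - A)) / l" using l by (simp add: field_simps)
      also have "\<dots> = x * (x - A) / l" unfolding X(3)[symmetric] by (simp add: algebra_simps)
      also have "\<dots> = l * y i" using 2 l by (simp add: y_def field_simps)
      finally show ?thesis .
    next
      case 3
      have "(\<Sum>j<n. weighted_adj f n ?E $$ (i, j) * y j) = (\<Sum>j\<in>{0}. edge_weight f ?E i j * y j)"
        by (rule weighted_adj_row_sum[OF i nb(3)[OF 3]]) (use d in auto)
      also have "\<dots> = l * y i"
        using 3 i deg(3)[of i] by (simp add: edge_weight_def deg(1) y_def p_def)
      finally show ?thesis .
    next
      case 4
      have "(\<Sum>j<n. weighted_adj f n ?E $$ (i, j) * y j) = (\<Sum>j\<in>{1}. edge_weight f ?E i j * y j)"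
        by (rule weighted_adj_row_sum[OF i nb(4)[OF 4 i]]) (use d in auto)
      also have "\<dots> = l * y i"
        using 4 i l deg(3)[of i] by (simp add: edge_weight_def deg[unfolded One_nat_def] y_def q_def)
      finally show ?thesis .
    qed
  qed
  have "\<exists>i<n. y i \<noteq> 0" using ypos[of 0] d by (intro exI[of _ 0]) simp
  then have ev: "eigenvalue (weighted_adj f n ?E) l"
    unfolding eigenvalue_iff_sums[OF weighted_adj_carrier]
    by (intro exI[of _ y] conjI allI impI eq)
  have "rho_f f n ?E \<le> l"
  proof (rule eigenvalue_le_of_positive_vector[OF weighted_adj_carrier rho_f_is_eigenvalue[OF ev],
        where y = y])
    fix i j assume ij: "i < n" "j < n"
    have "Defs.degree ?E i > 0" if "i < n" for i
    proof -
      consider "i = 0" | "i = 1" | "2 \<le> i" by linarith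
      then show ?thesis using deg(1,2) deg(3)[of i] d that by cases auto
    qed
    then have "edge_weight f ?E i j > 0"
      using ij by (auto simp: edge_weight_def intro!: P_star_pos[OF f])
    then show "0 \<le> weighted_adj f n ?E $$ (i, j)" using ij by (simp add: weighted_adj_index)
  qed (use ypos eq in auto)
  then show ?thesis using eigenvalue_le_rho_f[OF ev] by (simp add: l_def)
qed

text \<open>For d = 1 the first star contributes nothing and the quadratic collapses to x = (n - 1)
  * q^2. The star ends the chain of inequalities, so a lower bound suffices and any eigenvector will
  do.\<close>

lemma rho_f_star_ge:
  assumes f: "P_star f" and n: "3 \<le> n" and x: "double_star_root f n 1 x"
  shows "sqrt x \<le> rho_f f n (star n)"
proof (rule eigenvalue_le_rho_f)
  let ?E = "star n"
  define q where "q = f 1 (real (n - 1))"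
  define r where "r = sqrt (real (n - 1))"
  have q: "q > 0" unfolding q_def using n by (auto intro!: P_star_pos[OF f])
  have q2: "f (real (n - 1)) 1 = q" unfolding q_def using n by (auto intro!: P_star_sym[OF f])
  have r: "r > 0" "r * r = real (n - 1)" using n by (auto simp: r_def)
  have X: "x > 0" "x * (x - real (n - 2) * q\<^sup>2) = q\<^sup>2 * x"
    using x n by (auto simp: double_star_root_def q_def numeral_2_eq_2)
  then have "x - real (n - 2) * q\<^sup>2 = q\<^sup>2" by (simp add: mult.commute)
  then have "x = real (n - 1) * q\<^sup>2" using n by (simp add: algebra_simps of_nat_diff)
  then have sx: "sqrt x = r * q" using q by (simp add: r_def real_sqrt_mult)
  have nb: "{j. {j, 0} \<in> ?E} = {1..<n}" "\<And>i. 1 \<le> i \<Longrightarrow> i < n \<Longrightarrow> {j. {j, i} \<in> ?E} = {0}"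
    by (auto simp: star_def doubleton_eq_iff)
  have deg: "Defs.degree ?E 0 = n - 1" "\<And>i. 1 \<le> i \<Longrightarrow> i < n \<Longrightarrow> Defs.degree ?E i = 1"
    by (simp_all add: Defs.degree_def nb)
  define y where "y i = (if i = 0 then r else 1)" for i :: nat
  have "(\<Sum>j<n. weighted_adj f n ?E $$ (i, j) * y j) = sqrt x * y i" if i: "i < n" for i
  proof (cases "i = 0")
    case True
    have "(\<Sum>j<n. weighted_adj f n ?E $$ (0, j) * y j) = (\<Sum>j\<in>{1..<n}. edge_weight f ?E 0 j * y j)"
      by (rule weighted_adj_row_sum[OF _ nb(1)]) (use n in auto)
    also have "\<dots> = (\<Sum>j\<in>{1..<n}. q)"
    proof (intro sum.cong refl)
      fix j assume j: "j \<in> {1..<n}"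
      then have "edge_weight f ?E 0 j = q"
        using deg(2)[of j] by (simp only: edge_weight_def deg(1) q2 atLeastLessThan_iff of_nat_1)
      then show "edge_weight f ?E 0 j * y j = q" using j by (simp add: y_def)
    qed
    also have "\<dots> = r * r * q" by (simp add: r)
    finally show ?thesis using True by (simp add: sx y_def mult_ac)
  next
    case False
    then have i1: "1 \<le> i" by simp
    have "(\<Sum>j<n. weighted_adj f n ?E $$ (i, j) * y j) = (\<Sum>j\<in>{0}. edge_weight f ?E i j * y j)"
      by (rule weighted_adj_row_sum[OF i nb(2)[OF i1 i]]) (use n in auto)
    also have "\<dots> = q * r" using deg(1) deg(2)[OF i1 i] by (simp add: edge_weight_def y_def q_def)
    finally show ?thesis using False by (simp add: sx y_def)
  qed
  then show "eigenvalue (weighted_adj f n ?E) (sqrt x)"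
    unfolding eigenvalue_iff_sums[OF weighted_adj_carrier]
    by (intro exI[of _ y]) (use r n in \<open>auto simp: y_def intro!: exI[of _ 0]\<close>)
qed

section \<open>Extremal trees\<close>

lemma graph_iso_double_star:
  assumes V: "{..<n} = insert a (insert b (C \<union> D))" and ab: "a \<noteq> b"
    and notin: "a \<notin> C \<union> D" "b \<notin> C \<union> D" and CD: "C \<inter> D = {}"
    and card: "card C = d - 1" and d: "1 \<le> d" "d < n"
    and E: "E = insert {a, b} ((\<lambda>v. {v, a}) ` C \<union> (\<lambda>v. {v, b}) ` D)"
  shows "graph_iso n E (double_star d n)"
proof -
  have fin: "finite C" "finite D" using V by (metis finite_Un finite_insert finite_lessThan)+
  have "card {..<n} = card (insert a (insert b (C \<union> D)))" unfolding V ..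
  then have "n = card C + card D + 2"
    using fin ab notin CD by (simp add: card_Un_disjoint)
  then have cardD: "card D = card {d<..<n}" using card d by simp
  have "card C = card {2..d}" using card d by simp
  then obtain g where g: "bij_betw g C {2..d}" using finite_same_card_bij[OF fin(1)] by blast
  obtain h where h: "bij_betw h D {d<..<n}" using finite_same_card_bij[OF fin(2) _ cardD] by blast
  define \<pi> where "\<pi> v = (if v = a then 0 else if v = b then 1 else if v \<in> C then g v else h v)" for v
  have pa: "\<pi> a = 0" "\<pi> b = 1" using ab by (auto simp: \<pi>_def)
  have pC: "\<pi> v = g v" if "v \<in> C" for v using that notin by (auto simp: \<pi>_def)
  have pD: "\<pi> v = h v" if "v \<in> D" for v using that notin CD by (auto simp: \<pi>_def)
  have bC: "bij_betw \<pi> C {2..d}" using g by (subst bij_betw_cong[OF pC])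
  have bD: "bij_betw \<pi> D {d<..<n}" using h by (subst bij_betw_cong[OF pD])
  have "bij_betw \<pi> (C \<union> D) ({2..d} \<union> {d<..<n})"
    by (rule bij_betw_combine[OF bC bD]) auto
  then have "bij_betw \<pi> ({b} \<union> (C \<union> D)) ({1} \<union> ({2..d} \<union> {d<..<n}))"
    by (rule bij_betw_combine[rotated]) (use pa d in auto)
  then have "bij_betw \<pi> ({a} \<union> ({b} \<union> (C \<union> D))) ({0} \<union> ({1} \<union> ({2..d} \<union> {d<..<n})))"
    by (rule bij_betw_combine[rotated]) (use pa d in auto)
  moreover have "{a} \<union> ({b} \<union> (C \<union> D)) = {..<n}" unfolding V by auto
  moreover have "{0} \<union> ({1} \<union> ({2..d} \<union> {d<..<n})) = {..<n}"
  proof -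
    have "x = 0 \<or> x = 1 \<or> 2 \<le> x" for x :: nat by linarith
    then show ?thesis using d by force
  qed
  ultimately have bij: "bij_betw \<pi> {..<n} {..<n}" by simp
  have "(\<lambda>e. \<pi> ` e) ` E = insert {0, 1} ((\<lambda>v. {\<pi> v, 0}) ` C \<union> (\<lambda>v. {\<pi> v, 1}) ` D)"
    unfolding E by (simp add: image_Un image_image pa)
  also have "(\<lambda>v. {\<pi> v, 0}) ` C = (\<lambda>i. {i, 0}) ` {2..d}"
    unfolding bij_betw_imp_surj_on[OF bC, symmetric] by (simp add: image_image)
  also have "(\<lambda>v. {\<pi> v, 1}) ` D = (\<lambda>i. {i, 1}) ` {d<..<n}"
    unfolding bij_betw_imp_surj_on[OF bD, symmetric] by (simp add: image_image)
  also have "insert {0, 1} ((\<lambda>i. {i, 0}) ` {2..d} \<union> (\<lambda>i. {i, 1}) ` {d<..<n}) = double_star d n"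
    by (auto simp: double_star_def insert_commute)
  finally show ?thesis unfolding graph_iso_def using bij by auto
qed

lemma graph_iso_star:
  assumes u: "u < n" and E: "E = (\<lambda>v. {v, u}) ` ({..<n} - {u})"
  shows "graph_iso n E (star n)"
proof -
  have "card ({..<n} - {u}) = card {1..<n}" using u by simp
  then obtain h where h: "bij_betw h ({..<n} - {u}) {1..<n}"
    using finite_same_card_bij[of "{..<n} - {u}" "{1..<n}"] by auto
  define \<pi> where "\<pi> v = (if v = u then 0 else h v)" for v
  have p: "\<pi> v = h v" if "v \<in> {..<n} - {u}" for v using that by (simp add: \<pi>_def)
  have b: "bij_betw \<pi> ({..<n} - {u}) {1..<n}" using h by (subst bij_betw_cong[OF p])
  then have "bij_betw \<pi> ({u} \<union> ({..<n} - {u})) ({0} \<union> {1..<n})"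
    by (rule bij_betw_combine[rotated]) (auto simp: \<pi>_def)
  moreover have "{u} \<union> ({..<n} - {u}) = {..<n}" "{0} \<union> {1..<n} = {..<n}" using u by auto
  ultimately have bij: "bij_betw \<pi> {..<n} {..<n}" by simp
  have "(\<lambda>e. \<pi> ` e) ` E = (\<lambda>v. {\<pi> v, 0}) ` ({..<n} - {u})"
    unfolding E by (simp add: image_image \<pi>_def)
  also have "\<dots> = (\<lambda>i. {i, 0}) ` {1..<n}"
    unfolding bij_betw_imp_surj_on[OF b, symmetric] by (simp add: image_image)
  also have "\<dots> = star n" by (auto simp: star_def insert_commute)
  finally show ?thesis unfolding graph_iso_def using bij by auto
qed

context rooted_tree
begin

lemma graph_iso_star_if:
  assumes "card (children u) = n - 1"
  shows "graph_iso n E (star n)"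
proof (rule graph_iso_star[OF root])
  have "children u = V"
    by (rule card_subset_eq) (use assms root in \<open>auto simp: children_def\<close>)
  then have "par v = u" if "v \<in> V" for v using that by (auto simp: children_def)
  then show "E = (\<lambda>v. {v, u}) ` V" unfolding E_eq by simp
qed

text \<open>Both labellings are provided, with \<open>w\<close> or with \<open>u\<close> as vertex
  0, because a tree whose root has degree 3 has to be recognised as \<open>double_star 3 n\<close>
  and not only as \<open>double_star (n - 3) n\<close>.\<close>

lemma graph_iso_double_star_if:
  assumes w: "w \<in> children u" and all: "\<forall>v\<in>V. par v \<noteq> u \<longrightarrow> par v = w"
    and d: "d = n - card (children u)" "2 \<le> d"
  shows "graph_iso n E (double_star d n)" "graph_iso n E (double_star (n - d) n)"
proof -
  define C where "C = children w"
  define D where "D = children u - {w}"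
  have wV: "w \<in> V" "par w = u" using w by (auto simp: children_def)
  have "card (children u) > 0" using w by (auto simp: card_gt_0_iff)
  then have cu: "card (children u) = n - d" "d < n" using d by linarith+
  have notin: "w \<notin> C \<union> D" "u \<notin> C \<union> D"
    using wV by (auto simp: C_def D_def children_def)
  have CD: "C \<inter> D = {}" using wV by (auto simp: C_def D_def children_def)
  have V: "{..<n} = insert w (insert u (C \<union> D))"
    using all wV root by (auto simp: C_def D_def children_def)
  have "V = insert w (C \<union> D)" using V notin wV root by auto
  moreover have "(\<lambda>v. {v, par v}) ` C = (\<lambda>v. {v, w}) ` C" "(\<lambda>v. {v, par v}) ` D = (\<lambda>v. {v, u}) ` D"
    by (auto simp: C_def D_def children_def)
  ultimately have E: "E = insert {w, u} ((\<lambda>v. {v, w}) ` C \<union> (\<lambda>v. {v, u}) ` D)"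
    unfolding E_eq using wV by (simp add: image_Un)
  have cD: "card D = n - d - 1" using cu w by (simp add: D_def)
  have "card {..<n} = card (insert w (insert u (C \<union> D)))" unfolding V ..
  then have "n = card C + card D + 2"
    using notin CD wV by (simp add: card_Un_disjoint C_def D_def)
  then have cC: "card C = d - 1" using cD cu by simp
  show "graph_iso n E (double_star d n)"
    by (rule graph_iso_double_star[OF V _ notin CD cC _ _ E]) (use wV d cu in auto)
  have V': "{..<n} = insert u (insert w (D \<union> C))" using V by auto
  have E': "E = insert {u, w} ((\<lambda>v. {v, u}) ` D \<union> (\<lambda>v. {v, w}) ` C)"
    unfolding E by (auto simp: insert_commute)
  show "graph_iso n E (double_star (n - d) n)"
    by (rule graph_iso_double_star[OF V' _ _ _ _ _ _ _ E']) (use wV d cu notin CD cD in auto)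
qed

text \<open>Row sums give the weak bound. If \<open>k\<close> reached 2 * f 2 2, every vertex where
  the eigenvector has maximal modulus would have degree 2 and only neighbours of the same kind,
  which is impossible in a finite tree.\<close>

lemma eigenvalue_less_max_degree_2:
  assumes f: "P_star f" and ev: "eigenvalue (weighted_adj f n E) k"
    and deg: "\<And>v. v < n \<Longrightarrow> Defs.degree E v \<le> 2"
  shows "k < 2 * f 2 2"
proof (rule ccontr)
  define g where "g = f 2 2"
  have g: "g > 0" unfolding g_def by (intro P_star_pos[OF f]) auto
  assume "\<not> k < 2 * f 2 2"
  then have k: "2 * g \<le> k" by (simp add: g_def)
  obtain z i0 where i0: "i0 < n" "z i0 \<noteq> 0"
    and z: "\<And>i. i < n \<Longrightarrow> (\<Sum>j<n. weighted_adj f n E $$ (i, j) * z j) = k * z i"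
    using ev eigenvalue_iff_sums[OF weighted_adj_carrier] by blast
  define M where "M = Max ((\<lambda>i. \<bar>z i\<bar>) ` {..<n})"
  have zM: "\<bar>z j\<bar> \<le> M" if "j < n" for j using that by (auto simp: M_def)
  have M: "M > 0" using zM[OF i0(1)] i0 by linarith
  define Z where "Z = {i. i < n \<and> \<bar>z i\<bar> = M}"
  have "M \<in> (\<lambda>i. \<bar>z i\<bar>) ` {..<n}" unfolding M_def using i0 by (intro Max_in) auto
  then have Z: "Z \<noteq> {}" "finite Z" by (auto simp: Z_def)
  have key: "Defs.degree E i = 2 \<and> (\<forall>j. {j, i} \<in> E \<longrightarrow> j \<in> Z)" if i: "i \<in> Z" for i
  proof -
    let ?N = "{j. {j, i} \<in> E}"
    have iZ: "i < n" "\<bar>z i\<bar> = M" using i by (auto simp: Z_def)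
    have N: "?N \<subseteq> {..<n}" by (auto dest: edge_less)
    have ew: "0 \<le> edge_weight f E i j \<and> edge_weight f E i j \<le> g" if j: "j \<in> ?N" for j
    proof -
      have e: "{i, j} \<in> E" "{j, i} \<in> E" using j by (auto simp: insert_commute)
      have "real (Defs.degree E i) > 0" "real (Defs.degree E j) > 0"
        using edge_degree_pos[OF e(1)] edge_degree_pos[OF e(2)] by auto
      moreover have "real (Defs.degree E i) \<le> 2" "real (Defs.degree E j) \<le> 2"
        using deg[of i] deg[of j] edge_less[OF e(1)] by auto
      ultimately show ?thesis
        unfolding edge_weight_def g_def by (auto intro!: P_star_mono2[OF f] less_imp_le[OF P_star_pos[OF f]])
    qed
    have "2 * g * M \<le> k * M" using k M by simp
    also have "\<dots> \<le> \<bar>k * z i\<bar>" using iZ M by (simp add: abs_mult)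
    also have "\<dots> = \<bar>\<Sum>j\<in>?N. edge_weight f E i j * z j\<bar>"
      unfolding z[OF iZ(1), symmetric] weighted_adj_row_sum[OF iZ(1) refl N] ..
    also have "\<dots> \<le> (\<Sum>j\<in>?N. \<bar>edge_weight f E i j * z j\<bar>)" by (rule sum_abs)
    also have "\<dots> \<le> (\<Sum>j\<in>?N. g * \<bar>z j\<bar>)"
      by (rule sum_mono) (use ew in \<open>auto simp: abs_mult intro!: mult_right_mono\<close>)
    finally have 1: "2 * M \<le> (\<Sum>j\<in>?N. \<bar>z j\<bar>)"
      using g by (simp add: sum_distrib_left[symmetric] mult.assoc mult.left_commute[of 2])
    have le: "(\<Sum>j\<in>?N. \<bar>z j\<bar>) \<le> (\<Sum>j\<in>?N. M)"
      by (rule sum_mono) (use zM N in auto)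
    have cN: "(\<Sum>j\<in>?N. M) = real (Defs.degree E i) * M" by (simp add: Defs.degree_def)
    have "2 * M \<le> real (Defs.degree E i) * M" using 1 le cN by linarith
    then have d2: "Defs.degree E i = 2" using M deg[OF iZ(1)] by simp
    have "j \<in> Z" if j: "{j, i} \<in> E" for j
    proof (rule ccontr)
      assume "j \<notin> Z"
      then have "\<bar>z j\<bar> < M" using zM[of j] edge_less[OF j] by (fastforce simp: Z_def)
      then have "(\<Sum>j\<in>?N. \<bar>z j\<bar>) < (\<Sum>j\<in>?N. M)"
        using j zM N finite_neighbours[of i] by (intro sum_strict_mono_ex1) auto
      then show False using 1 unfolding cN d2 by simp
    qed
    then show ?thesis using d2 by blast
  qed
  \<comment> \<open>A deepest vertex of \<open>Z\<close> has degree 2, hence a child, and this child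
    lies in \<open>Z\<close> but deeper.\<close>
  define m where "m = Max (depth ` Z)"
  have "m \<in> depth ` Z" unfolding m_def using Z by (intro Max_in) auto
  then obtain i where i: "i \<in> Z" "depth i = m" by blast
  have "i < n" using i by (simp add: Z_def)
  have "Defs.degree E i = 2" using key[OF i(1)] by blast
  then have "card (children i) > 0" using degree_eq[OF \<open>i < n\<close>] by (simp split: if_splits)
  then obtain c where c: "c \<in> children i" by (auto simp: card_gt_0_iff)
  then have "{c, i} \<in> E" "depth c = Suc (depth i)" using par[of c] by (auto simp: children_def edge_iff)
  then have "c \<in> Z" using key[OF i(1)] by blast
  then have "depth c \<le> m" using Z(2) by (simp add: m_def)
  then show False using i \<open>depth c = Suc (depth i)\<close> by simp
qed

end

text \<open>With g = f 2 2, both star contributions are at least 2 * g^2 and the central weight is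
  at least g. For equality throughout, the quadratic would be (x - 2 * g^2)^2 = g^2 * x, whose roots
  are g^2 and 4 * g^2.\<close>

lemma double_star_root_3_ge:
  assumes f: "P_star f" and n: "n \<ge> 6" and x: "double_star_root f n 3 x"
  shows "2 * f 2 2 \<le> sqrt x"
proof -
  define g where "g = f 2 2"
  define p where "p = f 1 3"
  define q where "q = f 1 (real (n - 3))"
  define c where "c = f 3 (real (n - 3))"
  have r: "real (n - 3) \<ge> 3" "real (n - 3 - 1) \<ge> 2" using n by auto
  have X: "x > 2 * p\<^sup>2" "x > real (n - 3 - 1) * q\<^sup>2" "(x - 2 * p\<^sup>2) * (x - real (n - 3 - 1) * q\<^sup>2) = c\<^sup>2 * x"
    using x by (simp_all add: double_star_root_def p_def q_def c_def)
  have g: "g > 0" unfolding g_def by (intro P_star_pos[OF f]) auto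
  have gp: "g \<le> p" using P_star_spread[OF f, of 2 2] by (simp add: g_def p_def)
  have pq: "p \<le> q" unfolding p_def q_def by (rule P_star_mono2[OF f]) (use r in auto)
  have gc: "g \<le> c" unfolding g_def c_def by (rule P_star_mono2[OF f]) (use r in auto)
  have sq: "g\<^sup>2 \<le> p\<^sup>2" "g\<^sup>2 \<le> q\<^sup>2" "g\<^sup>2 \<le> c\<^sup>2" using g gp pq gc by (auto intro!: power_mono)
  have B: "2 * g\<^sup>2 \<le> real (n - 3 - 1) * q\<^sup>2" using sq r by (intro mult_mono) auto
  have x0: "x > 2 * g\<^sup>2" "g\<^sup>2 > 0" using X sq g by auto
  have "4 * g\<^sup>2 \<le> x"
  proof (rule ccontr)
    assume "\<not> 4 * g\<^sup>2 \<le> x"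
    then have "(x - g\<^sup>2) * (4 * g\<^sup>2 - x) > 0" using x0 by (intro mult_pos_pos) auto
    then have "(x - 2 * g\<^sup>2) * (x - 2 * g\<^sup>2) < g\<^sup>2 * x" by (simp add: algebra_simps)
    also have "\<dots> \<le> c\<^sup>2 * x" by (rule mult_right_mono) (use sq x0 in linarith)+
    also have "\<dots> = (x - 2 * p\<^sup>2) * (x - real (n - 3 - 1) * q\<^sup>2)" using X by simp
    also have "\<dots> \<le> (x - 2 * g\<^sup>2) * (x - 2 * g\<^sup>2)"
      by (rule mult_mono) (use X sq B x0 in linarith)+
    finally show False by simp
  qed
  then have "(2 * g)\<^sup>2 \<le> x" by (simp add: power_mult_distrib)
  then show ?thesis unfolding g_def[symmetric] by (rule real_le_rsqrt)
qed

theorem theorem3p1: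
  fixes f :: "real \<Rightarrow> real \<Rightarrow> real" and n :: nat
  assumes "P_star f" and "n \<ge> 6"
  shows "(\<forall>E. is_tree n E \<and> \<not> graph_iso n E (star n) \<and> \<not> graph_iso n E (double_star 2 n)
             \<and> \<not> graph_iso n E (double_star 3 n)
           \<longrightarrow> rho_f f n E < rho_f f n (double_star 3 n))
       \<and> rho_f f n (double_star 3 n) < rho_f f n (double_star 2 n)
       \<and> rho_f f n (double_star 2 n) < rho_f f n (star n)"
proof -
  note f = \<open>P_star f\<close> and n = \<open>n \<ge> 6\<close>
  obtain x1 where x1: "double_star_root f n 1 x1" using double_star_root_exists[OF f, of 1 n] n by auto
  obtain x2 where x2: "double_star_root f n 2 x2" using double_star_root_exists[OF f, of 2 n] n by auto
  obtain x3 where x3: "double_star_root f n 3 x3" using double_star_root_exists[OF f, of 3 n] n by auto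
  have r2: "rho_f f n (double_star 2 n) = sqrt x2" using rho_f_double_star[OF f _ _ _ x2] n by simp
  have r3: "rho_f f n (double_star 3 n) = sqrt x3" using rho_f_double_star[OF f _ _ _ x3] n by simp
  have r1: "sqrt x1 \<le> rho_f f n (star n)" using rho_f_star_ge[OF f _ x1] n by simp
  have x32: "sqrt x3 < sqrt x2"
    by (rule real_sqrt_less_mono, rule double_star_root_antimono[OF f _ _ _ x2 x3]) (use n in auto)
  \<comment> \<open>The star enters the monotone family as the case d = 1.\<close>
  have x21: "sqrt x2 < sqrt x1"
    by (rule real_sqrt_less_mono, rule double_star_root_antimono[OF f _ _ _ x1 x2]) (use n in auto)
  have "rho_f f n E < sqrt x3"
    if T: "is_tree n E" and n1: "\<not> graph_iso n E (star n)" and n2: "\<not> graph_iso n E (double_star 2 n)"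
      and n3: "\<not> graph_iso n E (double_star 3 n)" for E
  proof (cases "\<exists>u<n. Defs.degree E u \<ge> 3")
    case True
    then obtain u where u: "u < n" "Defs.degree E u \<ge> 3" by blast
    obtain par depth where rt: "rooted_tree n E u par depth" using tree_rooted[OF T u(1)] .
    interpret rooted_tree n E u par depth by (rule rt)
    define k where "k = rho_f f n E"
    have ev: "eigenvalue (weighted_adj f n E) k"
      unfolding k_def by (rule rho_f_eigenvalue[OF f _ finite_E simple]) (use n in auto)
    define d where "d = n - card (children u)"
    have cu: "card (children u) \<ge> 3" using u degree_eq[of u] by simp
    have cV: "card (children u) \<le> n - 1"
      using card_mono[of V "children u"] root by (auto simp: children_def)
    have "card (children u) \<noteq> n - 1" using graph_iso_star_if n1 by blast
    then have d2: "d \<ge> 2" using cV n by (simp add: d_def)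
    have dn: "d \<le> n - 3" "d \<noteq> 0" "n - d = card (children u)" using cu cV n by (auto simp: d_def)
    have "d < n" using dn(1) n by linarith
    \<comment> \<open>For d = 2 only one vertex is neither \<open>u\<close> nor adjacent to
      \<open>u\<close>, so the tree is the excluded double star.\<close>
    have "d \<noteq> 2"
    proof
      assume "d = 2"
      have "children u \<subseteq> V" by (auto simp: children_def)
      then have "card (V - children u) = n - 1 - card (children u)"
        using root by (simp add: card_Diff_subset)
      then have "card (V - children u) = 1"
        using dn(3) n by (simp add: \<open>d = 2\<close> flip: dn(3))
      then obtain v where v: "V - children u = {v}" by (auto simp: card_1_singleton_iff)
      then have v1: "v \<in> V" "par v \<noteq> u" by (auto simp: children_def)
      have "par v \<in> V" "par v \<noteq> v" using par[of v] par_neq[of v] v1 by auto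
      then have "par v \<in> children u" using v by blast
      moreover have "\<forall>v'\<in>V. par v' \<noteq> u \<longrightarrow> par v' = par v"
      proof (intro ballI impI)
        fix v' assume "v' \<in> V" "par v' \<noteq> u"
        then have "v' \<in> V - children u" by (simp add: children_def)
        then show "par v' = par v" using v by simp
      qed
      ultimately show False
        using graph_iso_double_star_if(1)[of "par v" d] n2 \<open>d = 2\<close> d_def by simp
    qed
    then have d3: "d \<ge> 3" using d2 by simp
    have ch: "children u \<noteq> {}" using cu by auto
    have tr: "tree_versus_double_star n E u par depth f d x" if "double_star_root f n d x" for x
      by unfold_locales (use f d_def d2 ch that in auto)
    show ?thesis
    \<comment> \<open>Here the comparison number is \<open>x3\<close> itself, so strictness must
      come from T not being this double star.\<close>
    proof (cases "d = 3 \<or> d = n - 3")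
      case True
      have "double_star_root f n d x3"
        using True x3 double_star_root_sym[OF f _ _ x3] n by auto
      note t = tr[OF this]
      have "\<not> (\<exists>w\<in>children u. \<forall>v\<in>V. par v \<noteq> u \<longrightarrow> par v = w)"
      proof
        assume "\<exists>w\<in>children u. \<forall>v\<in>V. par v \<noteq> u \<longrightarrow> par v = w"
        then obtain w where w: "w \<in> children u" "\<forall>v\<in>V. par v \<noteq> u \<longrightarrow> par v = w" by blast
        have "n - (n - 3) = 3" using n by simp
        then show False
          using graph_iso_double_star_if[OF w d_def d2] n3 True by auto
      qed
      from tree_versus_double_star.eigenvalue_less[OF t ev this] show ?thesis by (simp add: k_def)
    next
      case False
      obtain x where x: "double_star_root f n d x"
        using double_star_root_exists[OF f _ \<open>d < n\<close>] d2 n by auto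
      \<comment> \<open>Monotonicity holds only up to n / 2, so the smaller of the two parameters is
        used; it is at least 4, and the strict step is the one from \<open>x\<close> to
        \<open>x3\<close>.\<close>
      define e where "e = min d (n - d)"
      have e: "3 < e" "2 * e \<le> n" using False d3 dn(1) n unfolding e_def by linarith+
      have "double_star_root f n e x"
        using x double_star_root_sym[OF f _ \<open>d < n\<close> x] d2 by (simp add: e_def min_def)
      then have "x < x3" by (intro double_star_root_antimono[OF f _ e x3]) auto
      moreover have "k \<le> sqrt x" by (rule tree_versus_double_star.eigenvalue_le[OF tr[OF x] ev])
      ultimately show ?thesis unfolding k_def using real_sqrt_less_mono[of x x3] by linarith
    qed
  next
    case False
    obtain par depth where rt: "rooted_tree n E 0 par depth" using tree_rooted[OF T, of 0] n by auto
    interpret rooted_tree n E 0 par depth by (rule rt)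
    have "eigenvalue (weighted_adj f n E) (rho_f f n E)"
      by (rule rho_f_eigenvalue[OF f _ finite_E simple]) (use n in auto)
    then have "rho_f f n E < 2 * f 2 2"
      by (rule eigenvalue_less_max_degree_2[OF f]) (use False in force)
    then show ?thesis using double_star_root_3_ge[OF f n x3] by linarith
  qed
  then show ?thesis unfolding r2 r3 using x32 less_le_trans[OF x21 r1] by blast
qed

end
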